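(* Let $\alpha\in(0,1]$ be rational and let $M^{*}=M^{*}_{\alpha}$ be the $(\mathcal{C}^{>0}_{\alpha},\leq^{*}_{\alpha})$-generic structure. Then $M^{*}$ (equivalently, $\mathrm{Th}(M^{*})$) does not have the finite model property.
   Context: $\mathcal{L}=\{R\}$ with $R$ a ternary relation symbol; in all structures $R$ is symmetric and holds only of triples of distinct elements. $\mathcal{C}$ is the class of all finite such structures (including $\emptyset$). For $\alpha\in(0,1]$ and $A\in\mathcal{C}$, $\delta_{\alpha}(A)=|A|-\alpha|R^{A}|$, where $|R^{A}|$ is the number of relations in $A$ (counted as unordered triples). For finite $A\subseteq B$: $A\leq^{*}_{\alpha}B$ means $\delta_{\alpha}(A)<\delta_{\alpha}(C)$ for every $C$ with $A\subsetneq C\subseteq B$. $\mathcal{C}^{>0}_{\alpha}=\{A\in\mathcal{C}:\emptyset\leq^{*}_{\alpha}A\}$, and $\bar{\mathcal{C}}^{>0}_{\alpha}$ is the class of all $\mathcal{L}$-structures all of whose finite substructures lie in $\mathcal{C}^{>0}_{\alpha}$. For $M\in\bar{\mathcal{C}}^{>0}_{\alpha}$ and finite $A\subseteq M$, $A\leq^{*}_{\alpha}M$ means $A\leq^{*}_{\alpha}B$ for all finite $B$ with $A\subseteq B\subseteq M$. $M^{*}_{\alpha}$ is the (unique up to isomorphism) countable $\mathcal{L}$-structure $M$ with: (1) $M\in\bar{\mathcal{C}}^{>0}_{\alpha}$; (2) whenever $A\leq^{*}_{\alpha}M$ is finite and $A\leq^{*}_{\alpha}B\in\mathcal{C}^{>0}_{\alpha}$,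 there is $B'\subseteq M$ with $B'\cong_{A}B$ and $B'\leq^{*}_{\alpha}M$; (3) $M$ is the union of a chain $\{A_{i}:i\in\omega\}$ with $A_{i}\in\mathcal{C}^{>0}_{\alpha}$ and $A_{i}\leq^{*}_{\alpha}A_{i+1}$. A structure (or its complete theory) has the finite model property if every first-order sentence true in it has a finite model. *)

theory Defs
  imports Complex_Main "HOL-Library.Countable_Set" "HOL-Library.Infinite_Typeclass"
begin

record 'a lstruct =
  univ :: "'a set"
  rel :: "'a \<Rightarrow> 'a \<Rightarrow> 'a \<Rightarrow> bool"

text \<open>The two transpositions generate all permutations of the three arguments. Since the
  relation is required to be false outside the universe, two structures are equal as records
  precisely when they are the same structure.\<close>

definition lstructure :: "'a lstruct \<Rightarrow> bool" where
  "lstructure A \<longleftrightarrow>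
     (\<forall>x y z. rel A x y z \<longrightarrow>
        x \<in> univ A \<and> y \<in> univ A \<and> z \<in> univ A \<and>
        x \<noteq> y \<and> y \<noteq> z \<and> x \<noteq> z \<and>
        rel A y x z \<and> rel A x z y)"

definition empty_struct :: "'a lstruct" where
  "empty_struct = \<lparr>univ = {}, rel = (\<lambda>x y z. False)\<rparr>"

definition fin_struct :: "'a lstruct \<Rightarrow> bool" where
  "fin_struct A \<longleftrightarrow> lstructure A \<and> finite (univ A)"

definition substruct :: "'a lstruct \<Rightarrow> 'a lstruct \<Rightarrow> bool" where
  "substruct A B \<longleftrightarrow> lstructure A \<and> lstructure B \<and> univ A \<subseteq> univ B \<and>
     (\<forall>x\<in>univ A. \<forall>y\<in>univ A. \<forall>z\<in>univ A. rel A x y z \<longleftrightarrow> rel B x y z)"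

definition iso_over :: "'a lstruct \<Rightarrow> 'a lstruct \<Rightarrow> 'a lstruct \<Rightarrow> bool" where
  "iso_over A B B' \<longleftrightarrow>
     (\<exists>f. bij_betw f (univ B) (univ B') \<and>
          (\<forall>x\<in>univ B. \<forall>y\<in>univ B. \<forall>z\<in>univ B. rel B x y z \<longleftrightarrow> rel B' (f x) (f y) (f z)) \<and>
          (\<forall>a\<in>univ A. f a = a))"

definition triples :: "'a lstruct \<Rightarrow> 'a set set" where
  "triples A = {{x, y, z} | x y z. rel A x y z}"

definition delta :: "real \<Rightarrow> 'a lstruct \<Rightarrow> real" where
  "delta \<alpha> A = real (card (univ A)) - \<alpha> * real (card (triples A))"

definition strong :: "real \<Rightarrow> 'a lstruct \<Rightarrow> 'a lstruct \<Rightarrow> bool" where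
  "strong \<alpha> A B \<longleftrightarrow> fin_struct A \<and> fin_struct B \<and> substruct A B \<and>
     (\<forall>C. substruct A C \<and> A \<noteq> C \<and> substruct C B \<longrightarrow> delta \<alpha> A < delta \<alpha> C)"

definition Cpos :: "real \<Rightarrow> 'a lstruct set" where
  "Cpos \<alpha> = {A. fin_struct A \<and> strong \<alpha> empty_struct A}"

definition Cpos_bar :: "real \<Rightarrow> 'a lstruct set" where
  "Cpos_bar \<alpha> = {M. lstructure M \<and> (\<forall>A. fin_struct A \<and> substruct A M \<longrightarrow> A \<in> Cpos \<alpha>)}"

definition strong_in :: "real \<Rightarrow> 'a lstruct \<Rightarrow> 'a lstruct \<Rightarrow> bool" where
  "strong_in \<alpha> A M \<longleftrightarrow> fin_struct A \<and> substruct A M \<and>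
     (\<forall>B. fin_struct B \<and> substruct A B \<and> substruct B M \<longrightarrow> strong \<alpha> A B)"

text \<open>The extension \<open>B\<close> in the second clause lives on the same type as \<open>M\<close>, but is not otherwise
  related to \<open>M\<close> outside \<open>A\<close>. Provided the type is infinite, every finite extension of \<open>A\<close> has
  an isomorphic copy over \<open>A\<close> there, so the clause then covers all finite extensions;
  on a finite type it would be too weak.\<close>

definition generic :: "real \<Rightarrow> 'a::infinite lstruct \<Rightarrow> bool" where
  "generic \<alpha> M \<longleftrightarrow> countable (univ M) \<and>
     M \<in> Cpos_bar \<alpha> \<and>
     (\<forall>A B. strong_in \<alpha> A M \<and> strong \<alpha> A B \<and> B \<in> Cpos \<alpha> \<longrightarrow>
        (\<exists>B'. substruct B' M \<and> iso_over A B B' \<and> strong_in \<alpha> B' M)) \<and>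
     (\<exists>A :: nat \<Rightarrow> 'a lstruct.
        (\<forall>i. A i \<in> Cpos \<alpha> \<and> strong \<alpha> (A i) (A (Suc i))) \<and>
        univ M = (\<Union>i. univ (A i)) \<and>
        (\<forall>x y z. rel M x y z \<longleftrightarrow> (\<exists>i. rel (A i) x y z)))"

datatype fm =
    Eq nat nat
  | Rel nat nat nat
  | Neg fm
  | Conj fm fm
  | Ex nat fm

primrec fv :: "fm \<Rightarrow> nat set" where
  "fv (Eq i j) = {i, j}"
| "fv (Rel i j k) = {i, j, k}"
| "fv (Neg p) = fv p"
| "fv (Conj p q) = fv p \<union> fv q"
| "fv (Ex i p) = fv p - {i}"

definition sentence :: "fm \<Rightarrow> bool" where
  "sentence p \<longleftrightarrow> fv p = {}"

primrec sat :: "'a lstruct \<Rightarrow> (nat \<Rightarrow> 'a) \<Rightarrow> fm \<Rightarrow> bool" where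
  "sat M e (Eq i j) \<longleftrightarrow> e i = e j"
| "sat M e (Rel i j k) \<longleftrightarrow> rel M (e i) (e j) (e k)"
| "sat M e (Neg p) \<longleftrightarrow> \<not> sat M e p"
| "sat M e (Conj p q) \<longleftrightarrow> sat M e p \<and> sat M e q"
| "sat M e (Ex i p) \<longleftrightarrow> (\<exists>a\<in>univ M. sat M (e(i := a)) p)"

lemma sat_cong:
  "(\<And>i. i \<in> fv p \<Longrightarrow> e i = e' i) \<Longrightarrow> sat M e p \<longleftrightarrow> sat M e' p"
proof (induction p arbitrary: e e')
  case (Ex i p)
  have "sat M (e(i := a)) p \<longleftrightarrow> sat M (e'(i := a)) p" for a
    by (rule Ex.IH) (use Ex.prems in auto)
  then show ?case by simp
next
  case (Conj p q)
  have "sat M e p \<longleftrightarrow> sat M e' p"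
    by (rule Conj.IH(1)) (use Conj.prems in auto)
  moreover have "sat M e q \<longleftrightarrow> sat M e' q"
    by (rule Conj.IH(2)) (use Conj.prems in auto)
  ultimately show ?case by simp
next
  case (Neg p)
  have "sat M e p \<longleftrightarrow> sat M e' p"
    by (rule Neg.IH) (use Neg.prems in auto)
  then show ?case by simp
qed simp_all

text \<open>Truth of a sentence does not depend on the assignment (\<open>sat_cong\<close>). Assignments are not
  restricted to the universe, so that the definition is also correct for the empty structure,
  into which there are no assignments.\<close>

definition models :: "'a lstruct \<Rightarrow> fm \<Rightarrow> bool" where
  "models M p \<longleftrightarrow> (\<forall>e. sat M e p)"

lemma models_sentence: "sentence p \<Longrightarrow> models M p \<longleftrightarrow> sat M e p"
proof -
  assume "sentence p"
  then have "sat M e' p \<longleftrightarrow> sat M e p" for e'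
    by (intro sat_cong) (simp add: sentence_def)
  then show ?thesis unfolding models_def by iprover
qed

definition Th :: "'a lstruct \<Rightarrow> fm set" where
  "Th M = {p. sentence p \<and> models M p}"

text \<open>Every finite structure has an isomorphic copy on a set of natural numbers. As everywhere,
  structures are symmetric with distinct arguments, and the empty structure is admitted. Neither
  convention affects the finite model property of a nonempty structure, since symmetry,
  distinctness and nonemptiness can be added to a sentence as conjuncts.\<close>

definition has_finite_model :: "fm \<Rightarrow> bool" where
  "has_finite_model p \<longleftrightarrow> (\<exists>N :: nat lstruct. fin_struct N \<and> models N p)"

definition struct_fmp :: "'a lstruct \<Rightarrow> bool" where
  "struct_fmp M \<longleftrightarrow> (\<forall>p. sentence p \<and> models M p \<longrightarrow> has_finite_model p)"

definition theory_fmp :: "fm set \<Rightarrow> bool" where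
  "theory_fmp T \<longleftrightarrow> (\<forall>p\<in>T. has_finite_model p)"

end

theory Submission
  imports Defs
begin

text \<open>Write \<open>\<alpha> = p / q\<close>. A chain of \<open>p\<close> points \<open>x\<^sub>0, x\<^sub>1, \<dots>\<close> over parameters \<open>a, b\<^sub>0, \<dots>\<close> carries
  \<open>q\<close> relations \<open>{x\<^sub>l, x\<^sub>l\<^sub>-\<^sub>1, b\<^sub>j}\<close> (with \<open>x\<^sub>-\<^sub>1 = a\<close>), distributed as evenly as possible over
  the points. It has predimension 0 over its parameters, so it is contained in every strong
  substructure that contains them. Hence in \<open>M\<close> the set \<open>D\<close> of initial points of chains
  over \<open>a, b\<close> is finite, uniformly definable, and by genericity of any prescribed size. Genericity
  even allows us to link, by further chains, the elements of \<open>D\<close> injectively to elements of another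
  such set \<open>D'\<close>, missing one of them. So \<open>M\<close> satisfies the sentence saying that every
  set \<open>D\<close> is definably embedded as a proper subset of some \<open>D'\<close>; in a finite structure
  a set \<open>D\<close> of maximal size contradicts it.\<close>

section \<open>Weights along a chain\<close>

locale rational_weight =
  fixes p q :: nat
  assumes p_pos: "0 < p" and p_le_q: "p \<le> q"
begin

definition weight :: real where
  "weight = real p / real q"

text \<open>The number of relations attached to the \<open>l\<close>-th point of a chain; they sum up to \<open>q\<close>.\<close>

definition inc :: "nat \<Rightarrow> nat" where
  "inc l = q * Suc l div p - q * l div p"

text \<open>The predimension of the first \<open>n\<close> points of a chain over its parameters. It
  equals \<open>(q * n mod p) / q\<close>, which explains the bounds below.\<close>

definition slack :: "nat \<Rightarrow> real" where
  "slack n = real n - weight * real (q * n div p)"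

lemma weight_pos: "0 < weight" and weight_le_1: "weight \<le> 1"
  using p_pos p_le_q by (auto simp: weight_def)

text \<open>Since \<open>p \<le> q\<close>, the quotient grows by at least one at each step, so
  every point of a chain carries a relation.\<close>

lemma inc_pos: "0 < inc l"
proof -
  have "q * l div p + 1 = (q * l + p) div p" using p_pos by simp
  also have "\<dots> \<le> q * Suc l div p" using p_le_q by (intro div_le_mono) simp
  finally show ?thesis by (simp add: inc_def)
qed

text \<open>Keeps an index \<open>j < inc l\<close> within a list of \<open>q\<close>
  parameters.\<close>

lemma inc_le: "l < p \<Longrightarrow> inc l \<le> q"
proof -
  assume "l < p"
  then have "q * Suc l div p \<le> q * p div p"
    by (intro div_le_mono mult_le_mono2) simp
  then show ?thesis using p_pos by (simp add: inc_def)
qed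

lemma slack_0: "slack 0 = 0" and slack_p: "slack p = 0"
  using p_pos p_le_q by (auto simp: slack_def weight_def)

lemma slack_Suc: "slack (Suc n) = slack n + 1 - weight * real (inc n)"
proof -
  have "q * n div p \<le> q * Suc n div p" by (intro div_le_mono) simp
  then have "real (inc n) = real (q * Suc n div p) - real (q * n div p)"
    by (simp add: inc_def of_nat_diff)
  then show ?thesis unfolding slack_def by (simp only: right_diff_distrib of_nat_Suc)
qed

lemma slack_nonneg: "0 \<le> slack n" and slack_less: "slack n < weight"
proof -
  define d where "d = q * n div p"
  have "p * d + q * n mod p = q * n" by (simp add: d_def)
  moreover have "q * n mod p < p" using p_pos by simp
  ultimately have "p * d \<le> q * n" "q * n < p * d + p" by linarith+
  then have "real p * real d \<le> real q * real n" "real q * real n < real p * real d + real p"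
    by (metis of_nat_mult of_nat_le_iff, metis of_nat_mult of_nat_add of_nat_less_iff)
  moreover have q: "0 < real q" using p_pos p_le_q by simp
  then have "slack n = (real q * real n - real p * real d) / real q"
    unfolding slack_def weight_def d_def[symmetric] by (simp add: diff_divide_distrib)
  ultimately show "0 \<le> slack n" "slack n < weight"
    unfolding weight_def using q by (auto intro!: divide_nonneg_pos divide_strict_right_mono)
qed

text \<open>Below, index \<open>0\<close> stands for the parameter \<open>a\<close> and \<open>Suc l\<close> for the \<open>l\<close>-th point
  of a chain. Both estimates rest on \<open>0 \<le> slack n < weight \<le> 1\<close>: the slack is less than the
  cost of a point with no relations, and less than the weight of a single relation.\<close>

lemma path_weight_lower:
  fixes f :: "nat \<Rightarrow> bool"
  defines "W \<equiv> \<lambda>n. \<Sum>l<n. if f (Suc l) then 1 - (if f l then weight * real (inc l) else 0) else 0"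
  shows "W n \<ge> (if f n then slack n else 0)"
    and "\<not> f 0 \<Longrightarrow> l \<le> n \<Longrightarrow> f l \<Longrightarrow> 0 < W n"
proof -
  have *: "W n \<ge> (if f n then slack n else 0)" for n
  proof (induction n)
    case (Suc n)
    then show ?case
      using slack_nonneg[of n] slack_less[of "Suc n"] weight_le_1 slack_Suc[of n]
      by (auto simp: W_def split: if_splits)
  qed (simp add: W_def slack_0)
  show "W n \<ge> (if f n then slack n else 0)" by (rule *)
  show "0 < W n" if "\<not> f 0" "l \<le> n" "f l" for l
  proof -
    \<comment> \<open>Without \<open>a\<close>, the first present point of each run contributes a
      full 1, which exceeds every slack; the strict inequality then propagates along the
      run.\<close>
    have "(f n \<longrightarrow> slack n < W n) \<and> ((\<exists>l\<le>n. f l) \<longrightarrow> 0 < W n)" for n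
    proof (induction n)
      case (Suc n)
      then show ?case
        using *[of n] slack_nonneg[of n] slack_nonneg[of "Suc n"] slack_less[of "Suc n"]
          weight_le_1 slack_Suc[of n]
        by (auto simp: W_def le_Suc_eq split: if_splits)
    qed (use that in auto)
    then show ?thesis using that by blast
  qed
qed

lemma path_weight_upper:
  fixes g :: "nat \<Rightarrow> bool"
  assumes "\<not> g 0"
  shows "(\<Sum>l<n. (if g (Suc l) then 1 else 0) - (if g (Suc l) \<or> g l then weight * real (inc l) else 0))
    \<le> (if g n then slack n else 0)"
proof (induction n)
  case (Suc n)
  \<comment> \<open>When a run of marked points ends, the next point still brings at least one
    relation, and its weight exceeds the slack accumulated so far.\<close>
  have "weight * 1 \<le> weight * real (inc n)"
    using inc_pos[of n] weight_pos by (intro mult_left_mono) (auto simp: Suc_le_eq)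
  then obtain w where "weight * real (inc n) = w" "weight \<le> w" by simp
  then show ?case
    using Suc slack_nonneg[of n] slack_less[of n] weight_pos slack_Suc[of n]
    by (auto split: if_splits)
qed (use assms in simp)

section \<open>Predimension and chains\<close>

definition predim :: "'a set set \<Rightarrow> 'a set \<Rightarrow> real" where
  "predim E U = real (card U) - weight * real (card {T \<in> E. T \<subseteq> U})"

definition edges :: "'a \<Rightarrow> 'a list \<Rightarrow> 'a list \<Rightarrow> 'a set set" where
  "edges a bs xs = (\<lambda>(l, j). {xs ! l, (a # xs) ! l, bs ! j}) ` (SIGMA l:{..<p}. {..<inc l})"

text \<open>A relative form of strongness, tested on all finite \<open>C\<close> and not only on
  those containing \<open>A\<close>. For finite \<open>A\<close> inside \<open>U\<close>
  submodularity makes the two forms equivalent; this one is easily composed and makes sense for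
  infinite \<open>U\<close>.\<close>

definition strict :: "'a set set \<Rightarrow> 'a set \<Rightarrow> 'a set \<Rightarrow> bool" where
  "strict E A U \<longleftrightarrow> (\<forall>C. finite C \<and> C \<subseteq> U \<and> \<not> C \<subseteq> A \<longrightarrow> predim E (C \<inter> A) < predim E C)"

lemma finite_edges_in: "finite C \<Longrightarrow> finite {T \<in> E. T \<subseteq> C}"
  by (rule finite_subset[of _ "Pow C"]) auto

lemma in_edges_iff:
  "T \<in> edges a bs xs \<longleftrightarrow> (\<exists>l<p. \<exists>j<inc l. T = {xs ! l, (a # xs) ! l, bs ! j})"
  by (auto simp: edges_def)

lemma edges_subset_iff:
  "edges a bs xs \<subseteq> E \<longleftrightarrow> (\<forall>l<p. \<forall>j<inc l. {xs ! l, (a # xs) ! l, bs ! j} \<in> E)"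
  by (auto simp: edges_def)

text \<open>Cardinality is modular. A hyperedge inside \<open>A\<close> or \<open>B\<close> lies
  inside the union and one inside both lies inside the intersection, while the union may contain
  further ones.\<close>

lemma predim_submodular:
  assumes "finite A" "finite B"
  shows "predim E (A \<union> B) + predim E (A \<inter> B) \<le> predim E A + predim E B"
proof -
  let ?e = "\<lambda>U. {T \<in> E. T \<subseteq> U}"
  have "real (card (A \<union> B)) + real (card (A \<inter> B)) = real (card A) + real (card B)"
    using assms card_Un_Int[of A B] by linarith
  moreover have "card (?e A) + card (?e B) \<le> card (?e (A \<union> B)) + card (?e (A \<inter> B))"
  proof -
    have "card (?e A) + card (?e B) = card (?e A \<union> ?e B) + card (?e A \<inter> ?e B)"
      using assms by (intro card_Un_Int finite_edges_in)
    also have "?e A \<inter> ?e B = ?e (A \<inter> B)" by auto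
    also have "card (?e A \<union> ?e B) \<le> card (?e (A \<union> B))"
      using assms by (intro card_mono finite_edges_in) auto
    finally show ?thesis by simp
  qed
  then have "weight * (real (card (?e A)) + real (card (?e B)))
      \<le> weight * (real (card (?e (A \<union> B))) + real (card (?e (A \<inter> B))))"
    using weight_pos by (intro mult_left_mono) linarith+
  ultimately show ?thesis
    by (simp add: predim_def distrib_left)
qed

lemma card_index_set:
  assumes "distinct xs" "length xs = p"
  shows "card (set xs \<inter> C) = card {l. l < p \<and> xs ! l \<in> C}"
proof -
  have "set xs \<inter> C = (!) xs ` {l. l < p \<and> xs ! l \<in> C}"
    using assms by (auto simp: in_set_conv_nth)
  then show ?thesis
    using assms by (simp add: card_image inj_on_def nth_eq_iff_index_eq)
qed

text \<open>A relation inside \<open>C\<close> but not inside \<open>C \<inter> U\<close> joins a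
  chain point in \<open>C\<close> to its predecessor in \<open>C\<close>. Counting all such indices,
  whether or not the parameters lie in \<open>C\<close> and the relations differ, only weakens the
  bound, and \<open>path_weight_lower\<close> still suffices.\<close>

lemma predim_chain:
  fixes bs :: "'a list"
  assumes C: "finite C" "C \<subseteq> U \<union> set xs" and new: "set xs \<inter> U = {}" and "a \<in> U"
    and xs: "distinct xs" "length xs = p" and E: "\<And>T. T \<in> E \<Longrightarrow> T \<subseteq> U"
  defines "F \<equiv> E \<union> edges a bs xs"
  shows "predim F (C \<inter> U) \<le> predim F C"
    and "a \<notin> C \<Longrightarrow> \<not> C \<subseteq> U \<Longrightarrow> predim F (C \<inter> U) < predim F C"
proof -
  define f where "f l \<longleftrightarrow> (a # xs) ! l \<in> C" for l
  let ?L = "{l. l < p \<and> f (Suc l) \<and> f l}"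
  have C_eq: "C = (C \<inter> U) \<union> (set xs \<inter> C)" using C by auto
  have "card C = card (C \<inter> U) + card (set xs \<inter> C)"
    using C new by (subst C_eq, subst card_Un_disjoint) auto
  then have card_C: "card C = card (C \<inter> U) + card {l. l < p \<and> f (Suc l)}"
    by (simp add: card_index_set[OF xs] f_def)
  have sub: "{T \<in> F. T \<subseteq> C} \<subseteq> {T \<in> F. T \<subseteq> C \<inter> U} \<union>
      (\<lambda>(l, j). {xs ! l, (a # xs) ! l, bs ! j}) ` (SIGMA l:?L. {..<inc l})"
  proof
    fix T assume T: "T \<in> {T \<in> F. T \<subseteq> C}"
    show "T \<in> {T \<in> F. T \<subseteq> C \<inter> U} \<union>
      (\<lambda>(l, j). {xs ! l, (a # xs) ! l, bs ! j}) ` (SIGMA l:?L. {..<inc l})"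
    proof (cases "T \<in> E")
      case True
      then show ?thesis using E T by blast
    next
      case False
      then obtain l j where "l < p" "j < inc l" "T = {xs ! l, (a # xs) ! l, bs ! j}"
        using T by (auto simp: F_def in_edges_iff)
      then show ?thesis using T by (intro UnI2 image_eqI[of _ _ "(l, j)"]) (auto simp: f_def)
    qed
  qed
  have "card {T \<in> F. T \<subseteq> C} \<le> card ({T \<in> F. T \<subseteq> C \<inter> U} \<union>
      (\<lambda>(l, j). {xs ! l, (a # xs) ! l, bs ! j}) ` (SIGMA l:?L. {..<inc l}))" (is "_ \<le> card (?X \<union> ?Y)")
    using C by (intro card_mono sub) (auto simp: finite_edges_in)
  also have "\<dots> \<le> card ?X + card ?Y" by (rule card_Un_le)
  also have "card ?Y \<le> card (SIGMA l:?L. {..<inc l})" by (rule card_image_le) auto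
  also have "card (SIGMA l:?L. {..<inc l}) = (\<Sum>l\<in>?L. inc l)" by simp
  finally have "weight * real (card {T \<in> F. T \<subseteq> C})
      \<le> weight * (real (card {T \<in> F. T \<subseteq> C \<inter> U}) + real (\<Sum>l\<in>?L. inc l))"
    using weight_pos by (intro mult_left_mono) (simp_all flip: of_nat_add of_nat_sum)
  moreover have "real (card {l. l < p \<and> f (Suc l)}) - weight * real (\<Sum>l\<in>?L. inc l)
      = (\<Sum>l<p. if f (Suc l) then 1 - (if f l then weight * real (inc l) else 0) else 0)" (is "_ = ?W")
  proof -
    have "real (card {l. l < p \<and> f (Suc l)}) = (\<Sum>l<p. if f (Suc l) then 1 else 0)"
      by (simp add: sum.If_cases lessThan_def Collect_conj_eq)
    moreover have "weight * real (\<Sum>l\<in>?L. inc l)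
        = (\<Sum>l<p. if f (Suc l) \<and> f l then weight * real (inc l) else 0)"
      by (simp add: sum.If_cases lessThan_def Collect_conj_eq sum_distrib_left)
    ultimately show ?thesis by (simp flip: sum_subtractf) (intro sum.cong, auto)
  qed
  ultimately have *: "predim F (C \<inter> U) + ?W \<le> predim F C"
    by (simp add: predim_def card_C algebra_simps)
  show "predim F (C \<inter> U) \<le> predim F C"
    using * path_weight_lower(1)[of f p] slack_nonneg[of p] by (auto split: if_splits)
  assume "a \<notin> C" "\<not> C \<subseteq> U"
  then obtain l where "l < p" "xs ! l \<in> C"
    using C xs by (metis (no_types, lifting) in_set_conv_nth subsetI subsetD UnE)
  then have "0 < ?W"
    using \<open>a \<notin> C\<close> by (intro path_weight_lower(2)[of f "Suc l" p]) (auto simp: f_def)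
  with * show "predim F (C \<inter> U) < predim F C" by simp
qed

text \<open>Pass from \<open>C\<close> to \<open>C \<inter> U\<close> and then to
  \<open>C \<inter> A\<close>. Neither passage raises the predimension. The second lowers it if
  \<open>C \<inter> U\<close> leaves \<open>A\<close>; otherwise \<open>a \<notin> C\<close>,
  because \<open>a \<notin> A\<close>, and the first lowers it.\<close>

lemma strict_chain:
  fixes bs :: "'a list"
  assumes str: "strict E A U" and "A \<subseteq> U" and "a \<in> U" "a \<notin> A"
    and new: "set xs \<inter> U = {}" and xs: "distinct xs" "length xs = p"
    and E: "\<And>T. T \<in> E \<Longrightarrow> T \<subseteq> U"
  shows "strict (E \<union> edges a bs xs) A (U \<union> set xs)"
  unfolding strict_def
proof (intro allI impI, elim conjE)
  let ?F = "E \<union> edges a bs xs"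
  fix C assume C: "finite C" "C \<subseteq> U \<union> set xs" "\<not> C \<subseteq> A"
  have old: "predim ?F D = predim E D" if "D \<subseteq> U" for D
  proof -
    have "{T \<in> ?F. T \<subseteq> D} = {T \<in> E. T \<subseteq> D}"
    proof -
      have "\<not> T \<subseteq> D" if T: "T \<in> edges a bs xs" for T :: "'a set"
      proof -
        obtain l where "l < p" "xs ! l \<in> T" using T by (auto simp: in_edges_iff)
        then show ?thesis using \<open>D \<subseteq> U\<close> new xs by (metis disjoint_iff nth_mem subsetD)
      qed
      then show ?thesis by blast
    qed
    then show ?thesis by (simp add: predim_def)
  qed
  have CUA: "C \<inter> U \<inter> A = C \<inter> A" using assms(2) by auto
  note chain = predim_chain[where E = E and bs = bs, OF C(1,2) new \<open>a \<in> U\<close> xs E]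
  show "predim ?F (C \<inter> A) < predim ?F C"
  proof (cases "C \<inter> U \<subseteq> A")
    case True
    then have "C \<inter> U = C \<inter> A" "a \<notin> C" "\<not> C \<subseteq> U" using assms(2-4) C by auto
    then show ?thesis using chain(2) by simp
  next
    case False
    then have "predim E (C \<inter> U \<inter> A) < predim E (C \<inter> U)"
      using str C(1) unfolding strict_def by blast
    then show ?thesis
      using chain(1) old[of "C \<inter> A"] old[of "C \<inter> U"] assms(2) by (simp add: CUA le_infI2)
  qed
qed

text \<open>Equal pairs matched in opposite order would force both \<open>Suc l = l'\<close> and
  \<open>l = Suc l'\<close>.\<close>

lemma consecutive_inj:
  assumes "distinct ys" "Suc l < length ys" "Suc l' < length ys"
    and "{ys ! Suc l, ys ! l} = {ys ! Suc l', ys ! l'}"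
  shows "l = l'"
proof -
  from assms(4) consider "ys ! Suc l = ys ! Suc l'" | "ys ! Suc l = ys ! l'" "ys ! l = ys ! Suc l'"
    by (auto simp: doubleton_eq_iff)
  then show ?thesis
  proof cases
    case 1
    then show ?thesis using assms(1-3) by (simp add: nth_eq_iff_index_eq)
  next
    case 2
    then have "Suc l = l'" "l = Suc l'"
      using assms(1-3) nth_eq_iff_index_eq[OF assms(1)] Suc_lessD by blast+
    then show ?thesis by simp
  qed
qed

text \<open>Intersecting a relation with \<open>set bs\<close> recovers its parameter, and
  intersecting it with \<open>set (a # xs)\<close> recovers its consecutive pair.\<close>

lemma edge_index_inj:
  assumes d: "distinct (a # bs @ xs)" and len: "length xs = p" "length bs = q"
  shows "inj_on (\<lambda>(l, j). {xs ! l, (a # xs) ! l, bs ! j}) (SIGMA l:{..<p}. {..<inc l})"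
proof -
  let ?ys = "a # xs" let ?e = "\<lambda>l j. {xs ! l, ?ys ! l, bs ! j}"
  have "l = l' \<and> j = j'"
    if *: "l < p" "j < inc l" "l' < p" "j' < inc l'" and eq: "?e l j = ?e l' j'" for l j l' j'
  proof
    have ys: "distinct ?ys" and disj: "set bs \<inter> set ?ys = {}" using d by auto
    have parts: "?e l j \<inter> set bs = {bs ! j} \<and> ?e l j \<inter> set ?ys = {?ys ! Suc l, ?ys ! l} \<and> j < length bs"
      if "l < p" "j < inc l" for l j
    proof -
      have "j < length bs" using that inc_le len by (metis less_le_trans)
      then have "xs ! l \<in> set ?ys" "?ys ! l \<in> set ?ys" "bs ! j \<in> set bs"
        using that len by (auto simp: nth_Cons split: nat.split)
      then show ?thesis using disj \<open>j < length bs\<close> unfolding disjoint_iff by auto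
    qed
    have "{bs ! j} = {bs ! j'}" and "{?ys ! Suc l, ?ys ! l} = {?ys ! Suc l', ?ys ! l'}"
      using parts[of l j] parts[of l' j'] * eq by metis+
    then show "j = j'" "l = l'"
      using parts[of l j] parts[of l' j'] * d len consecutive_inj[OF ys, of l l']
      by (simp_all add: nth_eq_iff_index_eq del: nth_Cons_Suc)
  qed
  note key = this
  show ?thesis
  proof (rule inj_onI)
    fix u v
    assume h: "u \<in> (SIGMA l:{..<p}. {..<inc l})" "v \<in> (SIGMA l:{..<p}. {..<inc l})"
      "(case u of (l, j) \<Rightarrow> ?e l j) = (case v of (l, j) \<Rightarrow> ?e l j)"
    obtain l j l' j' where "u = (l, j)" "v = (l', j')" by fastforce
    then show "u = v" using key[of l j l' j'] h by simp
  qed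
qed

text \<open>If points were missing from \<open>A\<close>, adding them would bring in every relation
  that involves one of them. By \<open>path_weight_upper\<close> and \<open>slack_p\<close> the
  predimension would not increase, against strictness.\<close>

lemma chain_in_strict:
  assumes str: "strict E A U" and A: "finite A" "A \<subseteq> U" "a \<in> A"
    and xs: "distinct (a # bs @ xs)" "length xs = p" "length bs = q" "set xs \<subseteq> U" "set bs \<subseteq> A"
    and E: "edges a bs xs \<subseteq> E"
  shows "set xs \<subseteq> A"
proof (rule ccontr)
  assume not: "\<not> set xs \<subseteq> A"
  \<comment> \<open>\<open>g\<close> marks the missing points, and \<open>g 0\<close> is false
    because \<open>a \<in> A\<close>. As the parameters lie in \<open>A\<close>, a relation is new
    exactly if one of its two consecutive points is missing.\<close>
  define g where "g l \<longleftrightarrow> (a # xs) ! l \<notin> A" for l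
  let ?C = "A \<union> set xs" let ?L = "{l. l < p \<and> (g (Suc l) \<or> g l)}"
  let ?e = "\<lambda>(l, j). {xs ! l, (a # xs) ! l, bs ! j}"
  have CA: "?C \<inter> A = A" by auto
  have lt: "predim E A < predim E ?C"
    using str[unfolded strict_def, rule_format, of ?C] not A xs by (simp add: CA)
  have "card ?C = card A + card (set xs \<inter> - A)"
    using A by (subst card_Un_disjoint[symmetric]) (auto intro: arg_cong[where f=card])
  then have card_C: "card ?C = card A + card {l. l < p \<and> g (Suc l)}"
    using xs by (simp add: card_index_set g_def)
  \<comment> \<open>The number of relations is now bounded from below, so different indices must
    give different relations.\<close>
  have inj: "inj_on ?e (SIGMA l:?L. {..<inc l})"
    by (rule inj_on_subset[OF edge_index_inj[OF xs(1-3)]]) auto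
  have sub: "{T \<in> E. T \<subseteq> A} \<union> ?e ` (SIGMA l:?L. {..<inc l}) \<subseteq> {T \<in> E. T \<subseteq> ?C}"
  proof -
    have "?e (l, j) \<in> E \<and> ?e (l, j) \<subseteq> ?C" if "l < p" "j < inc l" for l j
    proof -
      have "j < q" using that inc_le by (meson less_le_trans)
      then have "xs ! l \<in> set xs" "(a # xs) ! l \<in> set (a # xs)" "bs ! j \<in> set bs"
        using that xs by (auto simp: nth_Cons split: nat.split)
      moreover have "?e (l, j) \<in> edges a bs xs" using that by (auto simp: in_edges_iff)
      ultimately show ?thesis using E xs(5) A(3) by auto
    qed
    then show ?thesis by blast
  qed
  have disj: "{T \<in> E. T \<subseteq> A} \<inter> ?e ` (SIGMA l:?L. {..<inc l}) = {}"
    by (auto simp: g_def)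
  have "card {T \<in> E. T \<subseteq> A} + card (SIGMA l:?L. {..<inc l}) \<le> card {T \<in> E. T \<subseteq> ?C}"
    using card_mono[OF _ sub] A finite_edges_in[of ?C E] finite_edges_in[of A E]
    by (subst card_image[OF inj, symmetric], subst card_Un_disjoint[symmetric])
      (auto intro: disj simp: disj)
  also have "card (SIGMA l:?L. {..<inc l}) = (\<Sum>l\<in>?L. inc l)" by simp
  finally have "weight * (real (card {T \<in> E. T \<subseteq> A}) + real (\<Sum>l\<in>?L. inc l))
      \<le> weight * real (card {T \<in> E. T \<subseteq> ?C})"
    using weight_pos by (intro mult_left_mono) (simp_all flip: of_nat_add of_nat_sum)
  moreover have "real (card {l. l < p \<and> g (Suc l)}) - weight * real (\<Sum>l\<in>?L. inc l)
      = (\<Sum>l<p. (if g (Suc l) then 1 else 0)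
          - (if g (Suc l) \<or> g l then weight * real (inc l) else 0))" (is "_ = ?V")
  proof -
    have "real (card {l. l < p \<and> g (Suc l)}) = (\<Sum>l<p. if g (Suc l) then 1 else 0)"
      by (simp add: sum.If_cases lessThan_def Collect_conj_eq)
    moreover have "weight * real (\<Sum>l\<in>?L. inc l)
        = (\<Sum>l<p. if g (Suc l) \<or> g l then weight * real (inc l) else 0)"
      unfolding of_nat_sum sum_distrib_left
      by (subst sum.inter_filter[symmetric]) (auto intro: sum.cong)
    ultimately show ?thesis by (simp flip: sum_subtractf)
  qed
  moreover have "?V \<le> 0"
    using path_weight_upper[of g p] slack_p A(3) by (auto simp: g_def split: if_splits)
  ultimately show False using lt by (simp add: predim_def card_C algebra_simps)
qed

end

section \<open>Structures and hypergraphs\<close>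

definition restrict_struct :: "'a lstruct \<Rightarrow> 'a set \<Rightarrow> 'a lstruct" where
  "restrict_struct M U =
    \<lparr>univ = U, rel = (\<lambda>x y z. rel M x y z \<and> x \<in> U \<and> y \<in> U \<and> z \<in> U)\<rparr>"

text \<open>Encoding a structure by a set of triples makes symmetry automatic and turns the addition
  of relations into a union.\<close>

definition hyperstruct :: "'a set \<Rightarrow> 'a set set \<Rightarrow> 'a lstruct" where
  "hyperstruct U E = \<lparr>univ = U, rel = (\<lambda>x y z. {x, y, z} \<in> E)\<rparr>"

lemma univ_restrict [simp]: "univ (restrict_struct M U) = U"
  by (simp add: restrict_struct_def)

lemma substruct_restrict: "lstructure M \<Longrightarrow> U \<subseteq> univ M \<Longrightarrow> substruct (restrict_struct M U) M"
  unfolding substruct_def lstructure_def restrict_struct_def lstruct.simps by blast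

lemma lstructureD:
  assumes "lstructure M" "rel M x y z"
  shows "x \<in> univ M" "y \<in> univ M" "z \<in> univ M" "x \<noteq> y" "y \<noteq> z" "x \<noteq> z"
    "rel M y x z" "rel M x z y" "rel M z x y" "rel M y z x" "rel M z y x"
proof -
  have *: "x \<in> univ M \<and> y \<in> univ M \<and> z \<in> univ M \<and> x \<noteq> y \<and> y \<noteq> z \<and> x \<noteq> z \<and>
      rel M y x z \<and> rel M x z y" if "rel M x y z" for x y z
    using assms(1) that unfolding lstructure_def by blast
  show "x \<in> univ M" "y \<in> univ M" "z \<in> univ M" "x \<noteq> y" "y \<noteq> z" "x \<noteq> z"
    using *[OF assms(2)] by simp_all
  show 1: "rel M y x z" and 2: "rel M x z y" using *[OF assms(2)] by simp_all
  show "rel M z x y" and 3: "rel M y z x" using *[OF 1] *[OF 2] by simp_all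
  then show "rel M z y x" using *[OF 3] by simp
qed

lemma substruct_trans: "substruct A B \<Longrightarrow> substruct B C \<Longrightarrow> substruct A C"
  unfolding substruct_def by (auto simp: subset_eq)

lemma substruct_between:
  "substruct A M \<Longrightarrow> substruct B M \<Longrightarrow> univ A \<subseteq> univ B \<Longrightarrow> substruct A B"
  unfolding substruct_def by (auto simp: subset_eq)

text \<open>Relations vanish outside the universe, so an induced substructure is determined by its
  universe.\<close>

lemma substruct_eq:
  assumes "substruct A M" "substruct B M" "univ A = univ B"
  shows "A = B"
proof -
  have "rel A x y z \<longleftrightarrow> rel B x y z" for x y z
    using assms lstructureD(1-3)[of A x y z] lstructureD(1-3)[of B x y z]
    unfolding substruct_def by metis
  then have "rel A = rel B" by blast
  then show ?thesis using assms(3) by (cases A; cases B) simp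
qed

lemma rel_iff_triple:
  assumes "lstructure M"
  shows "rel M x y z \<longleftrightarrow> {x, y, z} \<in> triples M"
proof
  assume "{x, y, z} \<in> triples M"
  then obtain x' y' z' where *: "{x, y, z} = {x', y', z'}" "rel M x' y' z'"
    unfolding triples_def by auto
  note D = lstructureD[OF assms *(2)]
  \<comment> \<open>Cardinality 3 makes \<open>x\<close>, \<open>y\<close>, \<open>z\<close>
    distinct, hence a permutation of \<open>x'\<close>, \<open>y'\<close>, \<open>z'\<close>, and
    symmetry applies.\<close>
  have "card {x', y', z'} = 3" using D(4-6) by simp
  then have "card {x, y, z} = 3" using *(1) by simp
  then have dist: "x \<noteq> y" "y \<noteq> z" "x \<noteq> z" by (auto simp: card_insert_if split: if_splits)
  have "x = x' \<or> x = y' \<or> x = z'" "y = x' \<or> y = y' \<or> y = z'" "z = x' \<or> z = y' \<or> z = z'"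
    using *(1) by blast+
  then show "rel M x y z" by (elim disjE) (use D *(2) dist in simp_all)
qed (auto simp: triples_def)

lemma triples_substruct:
  assumes "substruct C M"
  shows "triples C = {T \<in> triples M. T \<subseteq> univ C}"
proof (intro set_eqI iffI)
  have C: "lstructure C" and M: "lstructure M" using assms by (auto simp: substruct_def)
  fix T
  show "T \<in> {T \<in> triples M. T \<subseteq> univ C}" if T_in: "T \<in> triples C"
  proof -
    obtain x y z where T: "T = {x, y, z}" "rel C x y z" using T_in by (auto simp: triples_def)
    then have "rel M x y z" using assms lstructureD(1-3)[OF C T(2)] by (auto simp: substruct_def)
    then show ?thesis using T lstructureD(1-3)[OF C T(2)] by (auto simp: triples_def)
  qed
  show "T \<in> triples C" if T_in: "T \<in> {T \<in> triples M. T \<subseteq> univ C}"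
  proof -
    obtain x y z where T: "T = {x, y, z}" "rel M x y z" "T \<subseteq> univ C"
      using T_in by (auto simp: triples_def)
    then have "rel C x y z" using assms by (auto simp: substruct_def)
    then show ?thesis using T by (auto simp: triples_def)
  qed
qed

lemma univ_hyperstruct [simp]: "univ (hyperstruct U E) = U"
  and rel_hyperstruct [simp]: "rel (hyperstruct U E) x y z \<longleftrightarrow> {x, y, z} \<in> E"
  by (simp_all add: hyperstruct_def)

lemma
  assumes "\<And>T. T \<in> E \<Longrightarrow> T \<subseteq> U \<and> card T = 3"
  shows lstructure_hyperstruct: "lstructure (hyperstruct U E)"
    and triples_hyperstruct: "triples (hyperstruct U E) = E"
proof -
  have "x \<in> U \<and> y \<in> U \<and> z \<in> U \<and> x \<noteq> y \<and> y \<noteq> z \<and> x \<noteq> z \<and> {y, x, z} \<in> E \<and> {x, z, y} \<in> E"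
    if "{x, y, z} \<in> E" for x y z
    using assms[OF that] that by (auto simp: card_insert_if insert_commute split: if_splits)
  then show "lstructure (hyperstruct U E)"
    unfolding lstructure_def rel_hyperstruct univ_hyperstruct by blast
  show "triples (hyperstruct U E) = E"
  proof (intro set_eqI iffI)
    fix T assume "T \<in> E"
    then obtain x y z where "T = {x, y, z}" using assms by (metis card_3_iff)
    then show "T \<in> triples (hyperstruct U E)" using \<open>T \<in> E\<close> by (auto simp: triples_def)
  qed (auto simp: triples_def)
qed

lemma exists_fresh_list:
  fixes U :: "'a::infinite set"
  assumes "finite U"
  obtains xs where "distinct xs" "length xs = n" "set xs \<inter> U = {}"
proof -
  have "infinite (- U)" using assms infinite_UNIV by (simp add: finite_compl)
  then obtain B where "finite B" "card B = n" "B \<subseteq> - U"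
    using infinite_arbitrarily_large by blast
  moreover from this obtain xs where "set xs = B" "distinct xs"
    using finite_distinct_list by blast
  ultimately show thesis using that[of xs] by (auto simp: distinct_card[symmetric])
qed

section \<open>Strong substructures in terms of strictness\<close>

context rational_weight
begin

lemma q_pos: "0 < q"
  using p_pos p_le_q by simp

text \<open>Lets all substructures of \<open>M\<close> be compared through the single edge set
  \<open>triples M\<close>.\<close>

lemma delta_eq_predim: "substruct C M \<Longrightarrow> delta weight C = predim (triples M) (univ C)"
  by (simp add: delta_def predim_def triples_substruct)

text \<open>Compare \<open>X\<close> with \<open>X \<inter> B\<close>, and this with
  \<open>X \<inter> A\<close>; at least one comparison is strict because \<open>X\<close> is not
  contained in \<open>A\<close>.\<close>

lemma strict_trans:
  assumes "strict E A B" "strict E B C" "A \<subseteq> B"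
  shows "strict E A C"
  unfolding strict_def
proof (intro allI impI, elim conjE)
  fix X assume X: "finite X" "X \<subseteq> C" "\<not> X \<subseteq> A"
  have XBA: "X \<inter> B \<inter> A = X \<inter> A" using assms(3) by auto
  have 1: "predim E (X \<inter> A) < predim E (X \<inter> B)" if "\<not> X \<inter> B \<subseteq> A"
    using assms(1) X that unfolding strict_def by (metis XBA finite_Int inf_le2)
  have 2: "predim E (X \<inter> B) < predim E X" if "\<not> X \<subseteq> B"
    using assms(2) X that unfolding strict_def by blast
  show "predim E (X \<inter> A) < predim E X"
  proof (cases "X \<subseteq> B")
    case True
    then show ?thesis using 1 X by (simp add: Int_absorb2)
  next
    case False
    show ?thesis
    proof (cases "X \<inter> B \<subseteq> A")
      case True
      then have "X \<inter> B = X \<inter> A" using assms(3) by auto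
      then show ?thesis using 2[OF False] by simp
    next
      case False': False
      then show ?thesis using 1 2[OF False] by simp
    qed
  qed
qed

text \<open>Strongness makes the union of \<open>A\<close> and \<open>C\<close> exceed
  \<open>A\<close> in predimension; submodularity transfers this gain to \<open>C\<close> over its
  intersection with \<open>A\<close>.\<close>

lemma strong_imp_strict:
  assumes "strong weight A B" "substruct B M"
  shows "strict (triples M) (univ A) (univ B)"
  unfolding strict_def
proof (intro allI impI, elim conjE)
  fix C assume C: "finite C" "C \<subseteq> univ B" "\<not> C \<subseteq> univ A"
  let ?D = "restrict_struct B (univ A \<union> C)"
  have AB: "substruct A B" and fin: "finite (univ A)"
    using assms by (auto simp: strong_def fin_struct_def)
  have DB: "substruct ?D B"
    using AB C by (intro substruct_restrict) (auto simp: substruct_def)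
  have "delta weight A < delta weight ?D"
    using assms(1) AB DB C substruct_between[OF AB DB]
    unfolding strong_def by (metis sup.cobounded1 sup.cobounded2 univ_restrict)
  then have "predim (triples M) (univ A) < predim (triples M) (univ A \<union> C)"
    using substruct_trans[OF AB assms(2)] substruct_trans[OF DB assms(2)]
    by (simp add: delta_eq_predim)
  then show "predim (triples M) (C \<inter> univ A) < predim (triples M) C"
    using predim_submodular[OF fin C(1), of "triples M"] by (simp add: Int_commute)
qed

lemma strict_imp_strong:
  assumes "fin_struct A" "fin_struct B" "substruct A B"
    "strict (triples B) (univ A) (univ B)"
  shows "strong weight A B"
  unfolding strong_def
proof (intro conjI allI impI assms(1-3), elim conjE)
  fix C assume C: "substruct A C" "A \<noteq> C" "substruct C B"
  then have "univ A \<noteq> univ C" using substruct_eq[OF assms(3) C(3)] by blast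
  then have "\<not> univ C \<subseteq> univ A" "univ C \<inter> univ A = univ A" "univ C \<subseteq> univ B"
    using C by (auto simp: substruct_def)
  moreover have "finite (univ C)"
    using calculation(3) assms(2) by (auto simp: fin_struct_def intro: finite_subset)
  ultimately show "delta weight A < delta weight C"
    using assms(4) C(3) assms(3) unfolding strict_def by (metis delta_eq_predim)
qed

lemma strict_imp_strong_in:
  assumes "fin_struct A" "substruct A M" "strict (triples M) (univ A) (univ M)"
  shows "strong_in weight A M"
  unfolding strong_in_def
proof (intro conjI allI impI assms(1,2), elim conjE)
  fix B assume B: "fin_struct B" "substruct A B" "substruct B M"
  have "strict (triples B) (univ A) (univ B)"
    unfolding strict_def
  proof (intro allI impI, elim conjE)
    fix C assume C: "finite C" "C \<subseteq> univ B" "\<not> C \<subseteq> univ A"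
    have eq: "predim (triples B) D = predim (triples M) D" if "D \<subseteq> univ B" for D
      using that by (auto simp: predim_def triples_substruct[OF B(3)] intro!: arg_cong[where f=card])
    have "C \<subseteq> univ M" using C(2) B(3) by (auto simp: substruct_def)
    then show "predim (triples B) (C \<inter> univ A) < predim (triples B) C"
      using assms(3) C eq[OF C(2)] eq[of "C \<inter> univ A"] unfolding strict_def
      by (simp add: le_infI1)
  qed
  then show "strong weight A B" using assms(1) B by (intro strict_imp_strong)
qed

text \<open>A finite \<open>C\<close> is tested inside the finite substructure on
  \<open>univ A \<union> C\<close>, in which \<open>A\<close> is strong.\<close>

lemma strong_in_imp_strict:
  assumes "strong_in weight A M"
  shows "strict (triples M) (univ A) (univ M)"
  unfolding strict_def
proof (intro allI impI, elim conjE)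
  fix C assume C: "finite C" "C \<subseteq> univ M" "\<not> C \<subseteq> univ A"
  let ?B = "restrict_struct M (univ A \<union> C)"
  have A: "fin_struct A" "substruct A M" using assms by (auto simp: strong_in_def)
  have BM: "substruct ?B M"
    using A C by (intro substruct_restrict) (auto simp: substruct_def)
  then have "substruct A ?B" using substruct_between[OF A(2) BM] by simp
  moreover have "fin_struct ?B" using A BM C by (auto simp: fin_struct_def substruct_def)
  ultimately have "strong weight A ?B" using assms BM by (auto simp: strong_in_def)
  from strong_imp_strict[OF this BM]
  show "predim (triples M) (C \<inter> univ A) < predim (triples M) C"
    using C unfolding strict_def by auto
qed

lemma substruct_empty:
  fixes A :: "'a lstruct"
  shows "lstructure A \<Longrightarrow> substruct empty_struct A"
proof -
  have "lstructure (empty_struct :: 'a lstruct)"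
    by (simp add: lstructure_def empty_struct_def)
  then show "lstructure A \<Longrightarrow> substruct empty_struct A"
    unfolding substruct_def by (simp add: empty_struct_def)
qed

lemma Cpos_iff: "A \<in> Cpos weight \<longleftrightarrow> fin_struct A \<and> strict (triples A) {} (univ A)"
proof
  assume A: "A \<in> Cpos weight"
  then have "substruct A A" by (simp add: Cpos_def fin_struct_def substruct_def)
  then show "fin_struct A \<and> strict (triples A) {} (univ A)"
    using A strong_imp_strict[of empty_struct A A] by (simp add: Cpos_def empty_struct_def)
next
  assume A: "fin_struct A \<and> strict (triples A) {} (univ A)"
  have "strong weight empty_struct A"
  proof (rule strict_imp_strong)
    show "fin_struct empty_struct" by (simp add: fin_struct_def lstructure_def empty_struct_def)
    show "substruct empty_struct A" using A by (simp add: substruct_empty fin_struct_def)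
    show "strict (triples A) (univ empty_struct) (univ A)" using A by (simp add: empty_struct_def)
  qed (use A in blast)
  then show "A \<in> Cpos weight" using A by (simp add: Cpos_def)
qed

text \<open>A member of the chain exhausting \<open>M\<close> serves: each finite set lies in some
  member, and every member is strict in all later ones by transitivity.\<close>

lemma finite_subset_strong_in:
  assumes "generic weight M" "finite X" "X \<subseteq> univ M"
  obtains A where "X \<subseteq> univ A" "strong_in weight A M" "A \<in> Cpos weight"
proof -
  have "\<exists>A :: nat \<Rightarrow> 'a lstruct.
      (\<forall>i. A i \<in> Cpos weight \<and> strong weight (A i) (A (Suc i))) \<and>
      univ M = (\<Union>i. univ (A i)) \<and> (\<forall>x y z. rel M x y z \<longleftrightarrow> (\<exists>i. rel (A i) x y z))"
    using assms(1) unfolding generic_def by (elim conjE)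
  then obtain A :: "nat \<Rightarrow> 'a lstruct"
    where "\<forall>i. A i \<in> Cpos weight \<and> strong weight (A i) (A (Suc i))"
      and univ_M: "univ M = (\<Union>i. univ (A i))"
      and rel_M: "\<forall>x y z. rel M x y z \<longleftrightarrow> (\<exists>i. rel (A i) x y z)"
    by (elim exE conjE) (rule that)
  then have Cpos: "A i \<in> Cpos weight" and Suc: "strong weight (A i) (A (Suc i))" for i
    by simp_all
  note A = Cpos Suc univ_M rel_M[rule_format]
  have M: "lstructure M" using assms(1) by (simp add: generic_def Cpos_bar_def)
  have fin: "fin_struct (A i)" for i using A(1) by (simp add: Cpos_def)
  have sub: "substruct (A i) (A (i + k))" for i k
  proof (induction k)
    case 0
    then show ?case using fin by (simp add: substruct_def fin_struct_def)
  next
    case (Suc k)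
    then show ?case using A(2)[of "i + k"] substruct_trans[OF Suc.IH] by (simp add: strong_def)
  qed
  have sub': "substruct (A i) (A j)" if "i \<le> j" for i j
    using sub[of i "j - i"] that by simp
  have subM: "substruct (A i) M" for i
    unfolding substruct_def
  proof (intro conjI M ballI)
    show "lstructure (A i)" using fin by (simp add: fin_struct_def)
    show "univ (A i) \<subseteq> univ M" using A(3) by auto
    fix x y z assume xyz: "x \<in> univ (A i)" "y \<in> univ (A i)" "z \<in> univ (A i)"
    show "rel (A i) x y z \<longleftrightarrow> rel M x y z"
    proof
      assume "rel M x y z"
      then obtain j where "rel (A j) x y z" using A(4) by blast
      \<comment> \<open>\<open>A i\<close> and \<open>A j\<close> are compared inside a later member
        that extends both.\<close>
      moreover have "substruct (A i) (A (max i j))" "substruct (A j) (A (max i j))"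
        by (auto intro: sub')
      ultimately show "rel (A i) x y z"
        using xyz fin lstructureD(1-3)[of "A j" x y z] unfolding substruct_def by metis
    qed (use A(4) in blast)
  qed
  have strict: "strict (triples M) (univ (A i)) (univ (A (i + k)))" for i k
  proof (induction k)
    case 0
    then show ?case by (simp add: strict_def)
  next
    case (Suc k)
    then show ?case
      using strong_imp_strict[OF A(2)[of "i + k"] subM] sub[of i k]
      by (auto simp: substruct_def intro: strict_trans)
  qed
  have cover: "\<exists>i. X \<subseteq> univ (A i)" if "finite X" "X \<subseteq> univ M" for X
    using that
  proof (induction X)
    case (insert x X)
    then obtain i j where "X \<subseteq> univ (A i)" "x \<in> univ (A j)" using A(3) by auto
    moreover have "univ (A i) \<subseteq> univ (A (max i j))" "univ (A j) \<subseteq> univ (A (max i j))"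
      using sub'[of i "max i j"] sub'[of j "max i j"] by (auto simp: substruct_def)
    ultimately show ?case by blast
  qed simp
  obtain i where i: "X \<subseteq> univ (A i)" using cover assms by blast
  have "strict (triples M) (univ (A i)) (univ M)"
    unfolding strict_def
  proof (intro allI impI, elim conjE)
    fix C assume C: "finite C" "C \<subseteq> univ M" "\<not> C \<subseteq> univ (A i)"
    then obtain j where j: "C \<subseteq> univ (A j)" using cover by blast
    have "univ (A j) \<subseteq> univ (A (i + j))" using sub'[of j "i + j"] by (simp add: substruct_def)
    then show "predim (triples M) (C \<inter> univ (A i)) < predim (triples M) C"
      using strict[of i j] C j unfolding strict_def by (meson order_trans)
  qed
  then have "strong_in weight (A i) M" using fin subM by (intro strict_imp_strong_in)
  then show thesis using that i A(1) by blast
qed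

section \<open>Chains in a structure and the sets they code\<close>

definition chain :: "'b lstruct \<Rightarrow> 'b \<Rightarrow> 'b list \<Rightarrow> 'b list \<Rightarrow> bool" where
  "chain M a bs xs \<longleftrightarrow> distinct (a # bs @ xs) \<and> length xs = p \<and> length bs = q \<and>
     set xs \<subseteq> univ M \<and> (\<forall>l<p. \<forall>j<inc l. rel M (xs ! l) ((a # xs) ! l) (bs ! j))"

text \<open>These are the definable sets that the sentence compares: only the first point of a chain
  is kept, the others are quantified away.\<close>

definition coded :: "'b lstruct \<Rightarrow> 'b \<Rightarrow> 'b list \<Rightarrow> 'b set" where
  "coded M a bs = {xs ! 0 |xs. chain M a bs xs}"

lemma coded_subset: "coded M a bs \<subseteq> univ M"
proof
  fix x assume "x \<in> coded M a bs"
  then obtain xs where "x = xs ! 0" "length xs = p" "set xs \<subseteq> univ M"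
    by (auto simp: coded_def chain_def)
  then show "x \<in> univ M" using p_pos nth_mem[of 0 xs] by auto
qed

text \<open>Of a chain found in \<open>M\<close>, this relation is all that is later pulled back to
  the constructed extension.\<close>

lemma chain_rel_0: "chain M a bs xs \<Longrightarrow> rel M (xs ! 0) a (bs ! 0)"
proof -
  assume "chain M a bs xs"
  then have "\<And>l j. l < p \<Longrightarrow> j < inc l \<Longrightarrow> rel M (xs ! l) ((a # xs) ! l) (bs ! j)"
    by (simp add: chain_def)
  from this[OF p_pos inc_pos] show ?thesis by simp
qed

lemma chain_in_strong:
  assumes "strong_in weight A M" "chain M a bs xs" "a \<in> univ A" "set bs \<subseteq> univ A"
  shows "set xs \<subseteq> univ A"
proof (rule chain_in_strict)
  have A: "fin_struct A" "substruct A M" using assms(1) by (auto simp: strong_in_def)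
  then have M: "lstructure M" by (simp add: substruct_def)
  show "strict (triples M) (univ A) (univ M)" using assms(1) by (rule strong_in_imp_strict)
  show "edges a bs xs \<subseteq> triples M"
    using assms(2) unfolding edges_subset_iff chain_def rel_iff_triple[OF M] by blast
  show "finite (univ A)" "univ A \<subseteq> univ M" using A by (auto simp: fin_struct_def substruct_def)
qed (use assms in \<open>auto simp: chain_def\<close>)

text \<open>Makes a coded set finite, since its parameters can be enclosed in a finite strong
  substructure.\<close>

lemma coded_in_strong:
  assumes "strong_in weight A M" "a \<in> univ A" "set bs \<subseteq> univ A"
  shows "coded M a bs \<subseteq> univ A"
proof
  fix x assume "x \<in> coded M a bs"
  then obtain xs where xs: "chain M a bs xs" "x = xs ! 0" by (auto simp: coded_def)
  then have "x \<in> set xs" using p_pos by (auto simp: chain_def)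
  then show "x \<in> univ A" using chain_in_strong[OF assms(1) xs(1) assms(2,3)] by blast
qed

lemma chain_hyperstruct:
  "chain (hyperstruct U E) a bs xs \<longleftrightarrow> distinct (a # bs @ xs) \<and> length xs = p \<and> length bs = q \<and>
     set xs \<subseteq> U \<and> edges a bs xs \<subseteq> E"
  unfolding chain_def edges_subset_iff rel_hyperstruct univ_hyperstruct by (rule refl)

lemma coded_mono:
  assumes "U \<subseteq> U'" "E \<subseteq> E'"
  shows "coded (hyperstruct U E) a bs \<subseteq> coded (hyperstruct U' E') a bs"
  using assms unfolding coded_def chain_hyperstruct by blast

text \<open>Every relation contains a chain point, and the base point \<open>a\<close> enters only
  together with the first one. This limits which clauses of \<open>stage\<close> a new chain can
  affect.\<close>

lemma edge_cases:
  assumes "distinct (a # bs @ xs)" "length xs = p" "length bs = q" "T \<in> edges a bs xs"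
  obtains x y b where "T = {x, y, b}" "x \<in> set xs" "b \<in> set bs" "card T = 3"
    "y = a \<and> x = xs ! 0 \<or> y \<in> set xs"
proof -
  obtain l j where l: "l < p" "j < inc l" and T: "T = {xs ! l, (a # xs) ! l, bs ! j}"
    using assms(4) by (auto simp: in_edges_iff)
  have "j < q" using l inc_le[of l] by simp
  then have x: "xs ! l \<in> set xs" and b: "bs ! j \<in> set bs" using l assms by auto
  have y: "(a # xs) ! l = a \<and> xs ! l = xs ! 0 \<or> (a # xs) ! l \<in> set xs"
  proof (cases l)
    case (Suc m)
    then have "xs ! m \<in> set xs" using l assms(2) by auto
    then show ?thesis using Suc by simp
  qed simp
  have "(a # xs) ! Suc l \<noteq> (a # xs) ! l"
    using assms(1,2) l nth_eq_iff_index_eq[of "a # xs" "Suc l" l] by (simp del: nth_Cons_Suc)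
  then have "xs ! l \<noteq> (a # xs) ! l" by simp
  moreover have "bs ! j \<noteq> xs ! l" "bs ! j \<noteq> (a # xs) ! l"
    using x b y assms(1) by auto
  ultimately have "card T = 3" using T by simp
  then show thesis using that T x b y by blast
qed

section \<open>Building the extension\<close>

text \<open>A partially built extension \<open>(U, E)\<close> of \<open>(A, E\<^sub>0)\<close>: the points coded by \<open>a, bs\<close> lie in
  \<open>V\<close>, and \<open>w x\<close> is the one to which \<open>x \<in> S\<close> is already linked. The last two clauses
  are stated for single relations because these are what a chain found in \<open>M\<close> can be
  pulled back to.\<close>

definition stage ::
    "'b set \<Rightarrow> 'b set set \<Rightarrow> 'b \<Rightarrow> 'b list \<Rightarrow> 'b set \<Rightarrow> 'b set \<Rightarrow> 'b set \<Rightarrow> 'b set set \<Rightarrow> ('b \<Rightarrow> 'b) \<Rightarrow> bool"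
  where "stage A E\<^sub>0 a bs V S U E w \<longleftrightarrow>
    (finite U \<and> A \<subseteq> U \<and> (\<forall>T\<in>E. T \<subseteq> U \<and> card T = 3) \<and>
     (\<forall>T. T \<subseteq> A \<longrightarrow> (T \<in> E \<longleftrightarrow> T \<in> E\<^sub>0)) \<and> strict E A U) \<and>
    (a \<in> U - A \<and> set bs \<subseteq> U - A \<and> distinct (a # bs) \<and> length bs = q) \<and>
    (S \<subseteq> A \<and> w ` S \<subseteq> U - A - insert a (set bs)) \<and>
    (\<forall>x\<in>S. w x \<in> coded (hyperstruct U E) a bs \<and>
       coded (hyperstruct U E) (w x) (x # tl bs) \<noteq> {}) \<and>
    (\<forall>u. {u, a, bs ! 0} \<in> E \<longrightarrow> u \<in> V) \<and>
    (\<forall>x\<in>S. \<forall>y\<in>A. \<forall>z. {z, w x, y} \<in> E \<longrightarrow> y = x)"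

text \<open>Such a point is the target of the next link or, once the construction stops, the point
  that all links miss.\<close>

definition unlinked :: "'b set \<Rightarrow> 'b \<Rightarrow> 'b list \<Rightarrow> 'b set \<Rightarrow> 'b set set \<Rightarrow> 'b \<Rightarrow> bool" where
  "unlinked A a bs U E v \<longleftrightarrow> v \<in> U - A - insert a (set bs) \<and> v \<in> coded (hyperstruct U E) a bs \<and>
     (\<forall>y\<in>A. \<forall>z. {z, v, y} \<notin> E)"

lemma stageD:
  assumes "stage A E\<^sub>0 a bs V S U E w"
  shows "finite U" "A \<subseteq> U" "\<And>T. T \<in> E \<Longrightarrow> T \<subseteq> U" "\<And>T. T \<in> E \<Longrightarrow> card T = 3"
    "\<And>T. T \<subseteq> A \<Longrightarrow> T \<in> E \<longleftrightarrow> T \<in> E\<^sub>0" "strict E A U"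
    "a \<in> U" "a \<notin> A" "set bs \<subseteq> U - A" "distinct (a # bs)" "length bs = q"
    "S \<subseteq> A" "w ` S \<subseteq> U - A - insert a (set bs)"
    "\<And>x. x \<in> S \<Longrightarrow> w x \<in> coded (hyperstruct U E) a bs"
    "\<And>x. x \<in> S \<Longrightarrow> coded (hyperstruct U E) (w x) (x # tl bs) \<noteq> {}"
    "\<And>u. {u, a, bs ! 0} \<in> E \<Longrightarrow> u \<in> V"
    "\<And>x y z. x \<in> S \<Longrightarrow> y \<in> A \<Longrightarrow> {z, w x, y} \<in> E \<Longrightarrow> y = x"
proof -
  note s = assms[unfolded stage_def]
  show "finite U" "A \<subseteq> U" "strict E A U" "a \<in> U" "a \<notin> A" "set bs \<subseteq> U - A" "distinct (a # bs)"
    "length bs = q" "S \<subseteq> A" "w ` S \<subseteq> U - A - insert a (set bs)"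
    using s by simp_all
  show "\<And>T. T \<in> E \<Longrightarrow> T \<subseteq> U" "\<And>T. T \<in> E \<Longrightarrow> card T = 3" "\<And>T. T \<subseteq> A \<Longrightarrow> T \<in> E \<longleftrightarrow> T \<in> E\<^sub>0"
    using s by blast+
  show "\<And>x. x \<in> S \<Longrightarrow> w x \<in> coded (hyperstruct U E) a bs"
    "\<And>x. x \<in> S \<Longrightarrow> coded (hyperstruct U E) (w x) (x # tl bs) \<noteq> {}"
    using s by blast+
  show "\<And>u. {u, a, bs ! 0} \<in> E \<Longrightarrow> u \<in> V"
    "\<And>x y z. x \<in> S \<Longrightarrow> y \<in> A \<Longrightarrow> {z, w x, y} \<in> E \<Longrightarrow> y = x"
    using s by blast+
qed

text \<open>A fresh chain over \<open>a\<close> and \<open>bs\<close> supplies the coded point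
  \<open>v\<close>. All its points and parameters avoid \<open>A\<close>, so it creates no link, and
  its only relation containing both \<open>a\<close> and \<open>bs ! 0\<close> starts at
  \<open>v\<close>.\<close>

lemma stage_add_start:
  fixes A :: "'a::infinite set"
  assumes st: "stage A E\<^sub>0 a bs V S U E w"
  obtains U' E' v where "stage A E\<^sub>0 a bs (insert v V) S U' E' w" "unlinked A a bs U' E' v" "v \<notin> U"
proof -
  note s = stageD[OF st]
  obtain xs where xs: "distinct xs" "length xs = p" "set xs \<inter> U = {}"
    using exists_fresh_list[OF s(1)] by metis
  let ?U = "U \<union> set xs" let ?E = "E \<union> edges a bs xs" let ?v = "xs ! 0"
  have dist: "distinct (a # bs @ xs)" using s(7,9,10) xs by auto
  have v: "?v \<in> set xs" using xs p_pos by simp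
  then have v_new: "?v \<notin> U" using xs by auto
  have new: "\<exists>x y b. T = {x, y, b} \<and> x \<in> set xs \<and> b \<in> set bs \<and> card T = 3 \<and>
      (y = a \<and> x = ?v \<or> y \<in> set xs)" if "T \<in> edges a bs xs" for T
    using edge_cases[OF dist xs(2) s(11) that] by metis
  have newA: "T \<inter> A = {}" if "T \<in> edges a bs xs" for T
    using new[OF that] s(2,8,9) xs(3) by auto
  have mono: "coded (hyperstruct U E) c cs \<subseteq> coded (hyperstruct ?U ?E) c cs" for c cs
    by (rule coded_mono) auto
  have "chain (hyperstruct ?U ?E) a bs xs"
    using dist xs s(11) by (simp add: chain_hyperstruct)
  then have coded: "?v \<in> coded (hyperstruct ?U ?E) a bs" by (auto simp: coded_def)
  have strict: "strict ?E A ?U"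
    by (rule strict_chain[OF s(6,2,7,8) xs(3,1,2) s(3)])
  have shape: "T \<subseteq> ?U \<and> card T = 3" if "T \<in> ?E" for T
  proof (cases "T \<in> E")
    case True
    then show ?thesis using s(3,4) by blast
  next
    case False
    then show ?thesis using new[of T] that s(7,9) by auto
  qed
  have inA: "T \<in> ?E \<longleftrightarrow> T \<in> E\<^sub>0" if "T \<subseteq> A" for T
  proof -
    have "T \<notin> edges a bs xs" using newA[of T] new[of T] that by blast
    then show ?thesis using s(5)[OF that] by simp
  qed
  have start: "u \<in> insert ?v V" if "{u, a, bs ! 0} \<in> ?E" for u
  proof (cases "{u, a, bs ! 0} \<in> E")
    case True
    then show ?thesis using s(16) by blast
  next
    case False
    then have edge: "{u, a, bs ! 0} \<in> edges a bs xs" using that by simp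
    obtain x y b where T: "{u, a, bs ! 0} = {x, y, b}" "x \<in> set xs" "b \<in> set bs"
      "y = a \<and> x = ?v \<or> y \<in> set xs" using new[OF edge] by blast
    have "a \<notin> set xs" "a \<notin> set bs" using dist by auto
    moreover have "a \<in> {x, y, b}" using T(1) by blast
    ultimately have "y = a" using T(2,3) by blast
    then have "x = ?v" using T(4) \<open>a \<notin> set xs\<close> by simp
    have "bs ! 0 \<in> set bs" using s(11) q_pos by simp
    then have "?v \<noteq> bs ! 0" "?v \<noteq> a" using v dist by auto
    moreover have "?v \<in> {u, a, bs ! 0}" using T(1) \<open>x = ?v\<close> by blast
    ultimately have "u = ?v" by blast
    then show ?thesis by simp
  qed
  have link: "y = x" if "x \<in> S" "y \<in> A" "{z, w x, y} \<in> ?E" for x y z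
    using that newA[of "{z, w x, y}"] s(17)[of x y z] by blast
  have old: "\<forall>x\<in>S. w x \<in> coded (hyperstruct ?U ?E) a bs \<and>
       coded (hyperstruct ?U ?E) (w x) (x # tl bs) \<noteq> {}"
    using s(14,15) mono by blast
  have "stage A E\<^sub>0 a bs (insert ?v V) S ?U ?E w"
    unfolding stage_def
  proof (intro conjI)
    show "finite ?U" "A \<subseteq> ?U" "a \<in> ?U - A" "set bs \<subseteq> ?U - A" "w ` S \<subseteq> ?U - A - insert a (set bs)"
      using s by auto
    show "\<forall>T\<in>?E. T \<subseteq> ?U \<and> card T = 3" using shape by simp
    show "\<forall>T. T \<subseteq> A \<longrightarrow> (T \<in> ?E \<longleftrightarrow> T \<in> E\<^sub>0)" using inA by simp
    show "\<forall>u. {u, a, bs ! 0} \<in> ?E \<longrightarrow> u \<in> insert ?v V" using start by simp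
    show "\<forall>x\<in>S. \<forall>y\<in>A. \<forall>z. {z, w x, y} \<in> ?E \<longrightarrow> y = x" using link by blast
  qed (fact strict old s(10) s(11) s(12))+
  moreover have "unlinked A a bs ?U ?E ?v"
  proof -
    have "{z, ?v, y} \<notin> ?E" if "y \<in> A" for y z
      using newA[of "{z, ?v, y}"] s(3)[of "{z, ?v, y}"] v_new that by blast
    then show ?thesis
      unfolding unlinked_def using v v_new coded s(2,7,9) by auto
  qed
  ultimately show thesis using v_new by (rule that)
qed

text \<open>The link is a fresh chain over the base point \<open>v\<close> with \<open>x\<close> in
  place of the first entry of \<open>bs\<close>. Among its points and parameters only
  \<open>x\<close> lies in \<open>A\<close>, so \<open>v\<close> gets linked to nothing else in
  \<open>A\<close>; and \<open>v \<notin> A\<close> is what \<open>strict_chain\<close> demands of a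
  base point.\<close>

lemma stage_add_link:
  fixes A :: "'a::infinite set"
  assumes st: "stage A E\<^sub>0 a bs V S U E w" and un: "unlinked A a bs U E v"
    and v_S: "v \<notin> w ` S" and x: "x \<in> A" "x \<notin> S"
  obtains U' E' where "stage A E\<^sub>0 a bs V (insert x S) U' E' (w(x := v))"
proof -
  note s = stageD[OF st]
  have v: "v \<in> U" "v \<notin> A" "v \<noteq> a" "v \<notin> set bs" "v \<in> coded (hyperstruct U E) a bs"
    and v_free: "\<And>y z. y \<in> A \<Longrightarrow> {z, v, y} \<notin> E"
    using un by (auto simp: unlinked_def)
  let ?bs = "x # tl bs"
  have bs: "set (tl bs) \<subseteq> set bs" "distinct (tl bs)" "length ?bs = q"
    using s(10,11) q_pos by (auto simp: distinct_tl dest: list.set_sel(2)[rotated])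
  obtain zs where zs: "distinct zs" "length zs = p" "set zs \<inter> U = {}"
    using exists_fresh_list[OF s(1)] by metis
  let ?U = "U \<union> set zs" let ?E = "E \<union> edges v ?bs zs" let ?w = "w(x := v)"
  have x_new: "x \<in> U" "x \<noteq> v" "x \<notin> set bs" "x \<noteq> a" using x s(2,8,9) v by auto
  have dist: "distinct (v # ?bs @ zs)" using v bs x_new zs s(9) by auto
  have new: "\<exists>z y b. T = {z, y, b} \<and> z \<in> set zs \<and> b \<in> insert x (set bs) \<and> card T = 3 \<and>
      (y = v \<or> y \<in> set zs)" if T: "T \<in> edges v ?bs zs" for T
  proof -
    obtain z y b where "T = {z, y, b}" "z \<in> set zs" "b \<in> set ?bs" "card T = 3"
      "y = v \<and> z = zs ! 0 \<or> y \<in> set zs"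
      using edge_cases[OF dist zs(2) bs(3) T] by metis
    then show ?thesis using bs(1) by (intro exI[of _ z] exI[of _ y] exI[of _ b]) auto
  qed
  have new_sub: "T \<subseteq> set zs \<union> {v, x} \<union> set bs" if "T \<in> edges v ?bs zs" for T
    using new[OF that] by auto
  have mono: "coded (hyperstruct U E) c cs \<subseteq> coded (hyperstruct ?U ?E) c cs" for c cs
    by (rule coded_mono) auto
  have "chain (hyperstruct ?U ?E) v ?bs zs"
    using dist zs bs by (simp add: chain_hyperstruct)
  then have coded: "coded (hyperstruct ?U ?E) v ?bs \<noteq> {}" by (auto simp: coded_def)
  have strict: "strict ?E A ?U"
    by (rule strict_chain[OF s(6,2) v(1,2) zs(3,1,2) s(3)])
  have shape: "T \<subseteq> ?U \<and> card T = 3" if "T \<in> ?E" for T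
  proof (cases "T \<in> E")
    case True
    then show ?thesis using s(3,4) by blast
  next
    case False
    then have "T \<in> edges v ?bs zs" using that by simp
    then show ?thesis using new[of T] new_sub[of T] v(1) x_new(1) s(9) by blast
  qed
  have inA: "T \<in> ?E \<longleftrightarrow> T \<in> E\<^sub>0" if "T \<subseteq> A" for T
  proof -
    have "T \<notin> edges v ?bs zs" using new[of T] that zs(3) s(2) by blast
    then show ?thesis using s(5)[OF that] by simp
  qed
  \<comment> \<open>No new relation contains \<open>a\<close>, so the first relations of chains over
    \<open>a\<close> stay the same.\<close>
  have start: "u \<in> V" if "{u, a, bs ! 0} \<in> ?E" for u
  proof -
    have "a \<notin> set zs" "a \<notin> set bs" using s(7,10) zs(3) by auto
    then have "{u, a, bs ! 0} \<notin> edges v ?bs zs"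
      using new_sub[of "{u, a, bs ! 0}"] v(3) x_new(4) by blast
    then show ?thesis using that s(16) by blast
  qed
  have link: "y = x'" if "x' \<in> insert x S" "y \<in> A" "{z, ?w x', y} \<in> ?E" for x' y z
  proof (cases "x' = x")
    case True
    then have *: "{z, v, y} \<in> edges v ?bs zs" using that v_free by auto
    have "y \<notin> set zs" "y \<noteq> v" "y \<notin> set bs" using that(2) s(2,9) zs(3) v(2) by auto
    then show ?thesis using new_sub[OF *] True by blast
  next
    case False
    \<comment> \<open>An old target lies in \<open>U\<close> outside \<open>A\<close> and
      \<open>bs\<close> and differs from \<open>v\<close>, hence occurs in no new relation.\<close>
    then have x': "x' \<in> S" "?w x' = w x'" using that by auto
    then have "w x' \<in> U" "w x' \<notin> A" "w x' \<notin> set bs" using s(13) by auto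
    moreover have "w x' \<noteq> v" using v_S x' by auto
    ultimately have "{z, w x', y} \<notin> edges v ?bs zs"
      using new_sub[of "{z, w x', y}"] zs(3) x(1) by blast
    then show ?thesis using that x' s(17) by auto
  qed
  have old: "\<forall>x'\<in>insert x S. ?w x' \<in> coded (hyperstruct ?U ?E) a bs \<and>
       coded (hyperstruct ?U ?E) (?w x') (x' # tl bs) \<noteq> {}"
  proof
    fix x' assume x': "x' \<in> insert x S"
    show "?w x' \<in> coded (hyperstruct ?U ?E) a bs \<and> coded (hyperstruct ?U ?E) (?w x') (x' # tl bs) \<noteq> {}"
    proof (cases "x' = x")
      case True
      then show ?thesis using coded v(5) mono by auto
    next
      case False
      then have "x' \<in> S" "?w x' = w x'" using x' by auto
      then show ?thesis using s(14,15)[of x'] mono[of a bs] mono[of "w x'" "x' # tl bs"] by auto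
    qed
  qed
  have "stage A E\<^sub>0 a bs V (insert x S) ?U ?E ?w"
    unfolding stage_def
  proof (intro conjI)
    show "finite ?U" "A \<subseteq> ?U" "a \<in> ?U - A" "set bs \<subseteq> ?U - A" "insert x S \<subseteq> A"
      using s x by auto
    show "?w ` insert x S \<subseteq> ?U - A - insert a (set bs)" using s(13) v x(2) by auto
    show "\<forall>T\<in>?E. T \<subseteq> ?U \<and> card T = 3" using shape by simp
    show "\<forall>T. T \<subseteq> A \<longrightarrow> (T \<in> ?E \<longleftrightarrow> T \<in> E\<^sub>0)" using inA by simp
    show "\<forall>u. {u, a, bs ! 0} \<in> ?E \<longrightarrow> u \<in> V" using start by simp
    show "\<forall>x'\<in>insert x S. \<forall>y\<in>A. \<forall>z. {z, ?w x', y} \<in> ?E \<longrightarrow> y = x'" using link by blast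
  qed (fact strict old s(10) s(11))+
  then show thesis using that by blast
qed

text \<open>The induction keeps one unlinked coded point in reserve. It becomes the target of the
  next element of \<open>S\<close>, and a fresh chain then provides a new reserve.\<close>

lemma exists_stage:
  fixes A :: "'a::infinite set"
  assumes A: "finite A" and E: "\<And>T. T \<in> E\<^sub>0 \<Longrightarrow> T \<subseteq> A \<and> card T = 3"
    and S: "finite S" "S \<subseteq> A"
  obtains a bs U E w v where "stage A E\<^sub>0 a bs (insert v (w ` S)) S U E w"
    "unlinked A a bs U E v" "v \<notin> w ` S"
proof -
  obtain as where "distinct as" "length as = Suc q" "set as \<inter> A = {}"
    using exists_fresh_list[OF A] by metis
  then obtain a bs where bs: "distinct (a # bs)" "length bs = q" "set (a # bs) \<inter> A = {}"
    by (cases as) auto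
  let ?U = "A \<union> set (a # bs)"
  \<comment> \<open>The parameters start as isolated points, each of which raises the predimension
    by 1.\<close>
  have "strict E\<^sub>0 A ?U"
    unfolding strict_def
  proof (intro allI impI, elim conjE)
    fix C assume C: "finite C" "C \<subseteq> ?U" "\<not> C \<subseteq> A"
    then have "card (C \<inter> A) < card C" by (intro psubset_card_mono) auto
    moreover have "{T \<in> E\<^sub>0. T \<subseteq> C} = {T \<in> E\<^sub>0. T \<subseteq> C \<inter> A}" using E by blast
    ultimately show "predim E\<^sub>0 (C \<inter> A) < predim E\<^sub>0 C" by (simp add: predim_def)
  qed
  moreover have no_start: "{u, a, bs ! 0} \<notin> E\<^sub>0" for u using E[of "{u, a, bs ! 0}"] bs(3) by auto
  moreover have shape: "T \<subseteq> ?U \<and> card T = 3" if "T \<in> E\<^sub>0" for T using E[OF that] by auto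
  ultimately have base: "stage A E\<^sub>0 a bs {} {} ?U E\<^sub>0 (\<lambda>x. x)"
    unfolding stage_def using A bs by (auto simp del: distinct.simps)
  have "\<exists>U E w v. stage A E\<^sub>0 a bs (insert v (w ` S)) S U E w \<and> unlinked A a bs U E v \<and> v \<notin> w ` S"
    using S
  proof (induction S)
    case empty
    from stage_add_start[OF base] obtain U E v
      where "stage A E\<^sub>0 a bs {v} {} U E (\<lambda>x. x)" "unlinked A a bs U E v" by metis
    then show ?case by (intro exI[of _ U] exI[of _ E] exI[of _ "\<lambda>x. x"] exI[of _ v]) simp
  next
    case (insert x S)
    then obtain U E w v where IH: "stage A E\<^sub>0 a bs (insert v (w ` S)) S U E w"
      "unlinked A a bs U E v" "v \<notin> w ` S" by auto
    let ?w = "w(x := v)"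
    have img: "?w ` insert x S = insert v (w ` S)" using insert(2) by auto
    obtain U' E' where link: "stage A E\<^sub>0 a bs (insert v (w ` S)) (insert x S) U' E' ?w"
      using stage_add_link[OF IH, of x] insert.prems insert.hyps(2) by (metis insert_subset)
    obtain U'' E'' v' where new: "stage A E\<^sub>0 a bs (insert v' (insert v (w ` S))) (insert x S) U'' E'' ?w"
      "unlinked A a bs U'' E'' v'" "v' \<notin> U'"
      using stage_add_start[OF link] by metis
    \<comment> \<open>The new reserve lies outside \<open>U'\<close>, whereas all link targets lie
      inside.\<close>
    have "v' \<notin> ?w ` insert x S" using stageD(13)[OF link] new(3) by blast
    then show ?case
      using new(1,2)
      by (intro exI[of _ U''] exI[of _ E''] exI[of _ ?w] exI[of _ v']) (simp only: img simp_thms)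
  qed
  then show thesis using that by blast
qed

end

section \<open>The sentence\<close>

definition Imp_fm :: "fm \<Rightarrow> fm \<Rightarrow> fm" where
  "Imp_fm f g = Neg (Conj f (Neg g))"

definition All_fm :: "nat \<Rightarrow> fm \<Rightarrow> fm" where
  "All_fm i f = Neg (Ex i (Neg f))"

text \<open>The empty conjunction is a closed formula that holds in every structure, the empty one
  included.\<close>

definition conjs :: "fm list \<Rightarrow> fm" where
  "conjs fs = foldr Conj fs (All_fm 0 (Eq 0 0))"

primrec exs :: "nat \<Rightarrow> nat \<Rightarrow> fm \<Rightarrow> fm" where
  "exs k 0 f = f"
| "exs k (Suc n) f = exs k n (Ex (k + n) f)"

text \<open>The assignment reached once a quantifier block starting at variable \<open>k\<close> has
  chosen the values \<open>ys\<close>.\<close>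

definition override :: "(nat \<Rightarrow> 'a) \<Rightarrow> nat \<Rightarrow> 'a list \<Rightarrow> nat \<Rightarrow> 'a" where
  "override e k ys i = (if k \<le> i \<and> i < k + length ys then ys ! (i - k) else e i)"

primrec dist_fm :: "nat list \<Rightarrow> fm" where
  "dist_fm [] = conjs []"
| "dist_fm (v # vs) = Conj (conjs (map (\<lambda>u. Neg (Eq v u)) vs)) (dist_fm vs)"

lemma sat_Imp [simp]: "sat M e (Imp_fm f g) \<longleftrightarrow> (sat M e f \<longrightarrow> sat M e g)"
  and sat_All [simp]: "sat M e (All_fm i f) \<longleftrightarrow> (\<forall>a\<in>univ M. sat M (e(i := a)) f)"
  and fv_Imp [simp]: "fv (Imp_fm f g) = fv f \<union> fv g"
  and fv_All [simp]: "fv (All_fm i f) = fv f - {i}"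
  by (auto simp: Imp_fm_def All_fm_def)

lemma sat_conjs [simp]: "sat M e (conjs fs) \<longleftrightarrow> (\<forall>f\<in>set fs. sat M e f)"
  by (induction fs) (auto simp: conjs_def)

lemma fv_conjs [simp]: "fv (conjs fs) = (\<Union>f\<in>set fs. fv f)"
  by (induction fs) (auto simp: conjs_def)

lemma sat_dist_fm [simp]: "sat M e (dist_fm vs) \<longleftrightarrow> distinct (map e vs)"
  by (induction vs) (auto simp del: distinct_map)

lemma fv_dist_fm: "fv (dist_fm vs) \<subseteq> set vs"
  by (induction vs) auto

lemma fv_exs [simp]: "fv (exs k n f) = fv f - {k..<k + n}"
  by (induction n arbitrary: f) (auto simp: less_Suc_eq)

lemma override_snoc: "(override e k ys)(k + length ys := a) = override e k (ys @ [a])"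
  by (auto simp: override_def fun_eq_iff nth_append)

lemma override_outside: "i < k \<Longrightarrow> override e k ys i = e i"
  by (simp add: override_def)

lemma override_nth: "l < length ys \<Longrightarrow> override e k ys (k + l) = ys ! l"
  by (simp add: override_def)

lemma map_override: "n = length ys \<Longrightarrow> map (override e k ys) [k..<k + n] = ys"
  by (rule nth_equalityI) (auto simp: override_nth)

lemma map_override_outside: "set vs \<subseteq> {..<k} \<Longrightarrow> map (override e k ys) vs = map e vs"
  by (auto simp: override_outside subset_eq)

lemma sat_exs:
  "sat M e (exs k n f) \<longleftrightarrow>
     (\<exists>ys. length ys = n \<and> set ys \<subseteq> univ M \<and> sat M (override e k ys) f)"
proof (induction n arbitrary: f)
  case 0
  have "override e k [] = e" by (rule ext) (auto simp: override_def)
  then show ?case by simp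
next
  case (Suc n)
  have "sat M e (exs k (Suc n) f) \<longleftrightarrow> (\<exists>ys. length ys = n \<and> set ys \<subseteq> univ M \<and>
      (\<exists>a\<in>univ M. sat M ((override e k ys)(k + n := a)) f))"
    by (simp add: Suc)
  also have "\<dots> \<longleftrightarrow> (\<exists>ys a. length ys = n \<and> set (ys @ [a]) \<subseteq> univ M \<and>
      sat M (override e k (ys @ [a])) f)"
    using override_snoc[of e k] by (auto simp del: fun_upd_apply) metis+
  also have "\<dots> \<longleftrightarrow> (\<exists>ys. length ys = Suc n \<and> set ys \<subseteq> univ M \<and> sat M (override e k ys) f)"
    unfolding length_Suc_conv_rev by blast
  finally show ?case .
qed

declare upt_Suc [simp del]

section \<open>First-order definitions of coded sets and of growth\<close>

context rational_weight
begin

text \<open>The variables from \<open>k\<close> to \<open>k + p - 1\<close> hold the chain. The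
  other variables have to lie below \<open>k\<close> to escape capture.\<close>

definition coded_fm :: "nat \<Rightarrow> nat \<Rightarrow> nat \<Rightarrow> nat list \<Rightarrow> fm" where
  "coded_fm k v a bs = exs k p (conjs
     ([Eq v k, dist_fm (a # bs @ [k..<k + p])] @
      concat (map (\<lambda>l. map (\<lambda>j. Rel (k + l) ((a # [k..<k + p]) ! l) (bs ! j)) [0..<inc l]) [0..<p])))"

lemma sat_coded_fm:
  assumes "v < k" "a < k" "set bs \<subseteq> {..<k}" "length bs = q"
  shows "sat M e (coded_fm k v a bs) \<longleftrightarrow> e v \<in> coded M (e a) (map e bs)"
proof -
  have "sat M (override e k xs) (conjs
     ([Eq v k, dist_fm (a # bs @ [k..<k + p])] @
      concat (map (\<lambda>l. map (\<lambda>j. Rel (k + l) ((a # [k..<k + p]) ! l) (bs ! j)) [0..<inc l]) [0..<p])))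
    \<longleftrightarrow> e v = xs ! 0 \<and> distinct (e a # map e bs @ xs) \<and>
      (\<forall>l<p. \<forall>j<inc l. rel M (xs ! l) ((e a # xs) ! l) (map e bs ! j))" if xs: "length xs = p" for xs
  proof -
    let ?e = "override e k xs"
    have first: "?e v = e v" "?e k = xs ! 0"
      using assms override_nth[of 0 xs e k] xs p_pos by (auto simp: override_outside)
    have vars: "map ?e (a # bs @ [k..<k + p]) = e a # map e bs @ xs"
      using assms xs map_override[of p xs e k]
      by (simp add: override_outside map_override_outside)
    have el: "?e (k + l) = xs ! l \<and> ?e ((a # [k..<k + p]) ! l) = (e a # xs) ! l \<and>
        ?e (bs ! j) = map e bs ! j" if "l < p" "j < inc l" for l j
    proof -
      have j: "j < length bs" using that inc_le[of l] assms(4) by simp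
      then have "bs ! j < k" using assms(3) by (auto simp: subset_eq)
      moreover have "?e ((a # [k..<k + p]) ! l) = (e a # xs) ! l"
        using that xs assms(2) override_nth[of "l - 1" xs e k]
        by (cases l) (auto simp: override_outside)
      ultimately show ?thesis using that xs j by (simp add: override_nth override_outside)
    qed
    have sat: "sat M ?e (conjs ([Eq v k, dist_fm (a # bs @ [k..<k + p])] @
        concat (map (\<lambda>l. map (\<lambda>j. Rel (k + l) ((a # [k..<k + p]) ! l) (bs ! j)) [0..<inc l]) [0..<p])))
      \<longleftrightarrow> ?e v = ?e k \<and> distinct (map ?e (a # bs @ [k..<k + p])) \<and>
        (\<forall>l<p. \<forall>j<inc l. rel M (?e (k + l)) (?e ((a # [k..<k + p]) ! l)) (?e (bs ! j)))"
      by (auto simp: atLeast0LessThan simp del: map_append list.map distinct.simps dist_fm.simps)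
    have "(\<forall>l<p. \<forall>j<inc l. rel M (?e (k + l)) (?e ((a # [k..<k + p]) ! l)) (?e (bs ! j)))
      \<longleftrightarrow> (\<forall>l<p. \<forall>j<inc l. rel M (xs ! l) ((e a # xs) ! l) (map e bs ! j))"
      using el by simp
    then show ?thesis unfolding sat vars by (simp only: first)
  qed
  then have "sat M e (coded_fm k v a bs) \<longleftrightarrow>
      (\<exists>xs. length xs = p \<and> set xs \<subseteq> univ M \<and> e v = xs ! 0 \<and> distinct (e a # map e bs @ xs) \<and>
        (\<forall>l<p. \<forall>j<inc l. rel M (xs ! l) ((e a # xs) ! l) (map e bs ! j)))"
    unfolding coded_fm_def sat_exs by (simp only: cong: conj_cong)
  also have "\<dots> \<longleftrightarrow> e v \<in> coded M (e a) (map e bs)"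
    using assms(4) by (auto simp: coded_def chain_def)
  finally show ?thesis .
qed

lemma fv_coded_fm:
  assumes "length bs = q"
  shows "fv (coded_fm k v a bs) \<subseteq> {v, a} \<union> set bs"
proof -
  have "(a # [k..<k + p]) ! l \<in> insert a {k..<k + p}" if "l < p" for l
    using that by (cases l) auto
  moreover have "bs ! j \<in> set bs" if "l < p" "j < inc l" for l j
    using that inc_le[of l] assms by simp
  ultimately show ?thesis
    using fv_dist_fm[of "a # bs @ [k..<k + p]"] p_pos unfolding coded_fm_def
    by (auto simp del: dist_fm.simps) (metis insertE atLeastLessThan_iff)+
qed

text \<open>A link is itself witnessed by a chain, with base point \<open>y\<close> and with
  \<open>x\<close> as first parameter, and is therefore definable from \<open>bs\<close>.\<close>

definition linked :: "'b lstruct \<Rightarrow> 'b list \<Rightarrow> 'b \<Rightarrow> 'b \<Rightarrow> bool" where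
  "linked M bs x y \<longleftrightarrow> coded M y (x # tl bs) \<noteq> {}"

text \<open>Links form a relation, not a function; the clauses ensure that any choice of links is an
  injection of the first coded set into the second that misses a point.\<close>

definition outgrown :: "'b lstruct \<Rightarrow> 'b \<Rightarrow> 'b list \<Rightarrow> 'b \<Rightarrow> 'b list \<Rightarrow> bool" where
  "outgrown M a bs a' bs' \<longleftrightarrow>
     (\<forall>x\<in>coded M a bs. \<exists>y\<in>coded M a' bs'. linked M bs' x y) \<and>
     (\<forall>x\<in>coded M a bs. \<forall>x'\<in>coded M a bs. \<forall>y\<in>coded M a' bs'.
        linked M bs' x y \<longrightarrow> linked M bs' x' y \<longrightarrow> x = x') \<and>
     (\<exists>y\<in>coded M a' bs'. \<forall>x\<in>coded M a bs. \<not> linked M bs' x y)"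

text \<open>The pair \<open>a, bs\<close> occupies the variables \<open>0, \<dots>, q\<close> and the pair \<open>a', bs'\<close> the
  variables \<open>q + 1, \<dots>, 2 * q + 1\<close>.\<close>

definition linked_fm :: "nat \<Rightarrow> nat \<Rightarrow> fm" where
  "linked_fm x y =
     Ex (2 * q + 5) (coded_fm (2 * q + 6) (2 * q + 5) y (x # [q + 3..<2 * q + 2]))"

definition old_fm :: "nat \<Rightarrow> fm" where
  "old_fm x = coded_fm (2 * q + 6) x 0 [1..<Suc q]"

definition new_fm :: "nat \<Rightarrow> fm" where
  "new_fm y = coded_fm (2 * q + 6) y (Suc q) [q + 2..<2 * q + 2]"

text \<open>After the two pairs come three variables for points of the coded sets;
  \<open>2 * q + 5\<close> is reserved for the start of a linking chain, and chains are quantified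
  from \<open>2 * q + 6\<close> on.\<close>

definition outgrown_fm :: fm where
  "outgrown_fm = (let x = 2 * q + 2; x' = 2 * q + 3; y = 2 * q + 4 in
     Conj (All_fm x (Imp_fm (old_fm x) (Ex y (Conj (new_fm y) (linked_fm x y)))))
       (Conj (All_fm x (All_fm x' (All_fm y (Imp_fm (old_fm x) (Imp_fm (old_fm x') (Imp_fm (new_fm y)
           (Imp_fm (linked_fm x y) (Imp_fm (linked_fm x' y) (Eq x x')))))))))
         (Ex y (Conj (new_fm y) (All_fm x (Imp_fm (old_fm x) (Neg (linked_fm x y))))))))"

text \<open>The first conjunct excludes the empty structure, in which the second holds
  vacuously.\<close>

definition growth_fm :: fm where
  "growth_fm = Conj (Ex 0 (Eq 0 0))
     (Neg (exs 0 (Suc q) (Neg (exs (Suc q) (Suc q) outgrown_fm))))"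

lemma length_link_params: "length (x # [q + 3..<2 * q + 2]) = q"
  using q_pos by simp

lemma sat_linked_fm:
  assumes "x < 2 * q + 5" "y < 2 * q + 5" "map e [q + 2..<2 * q + 2] = bs"
  shows "sat M e (linked_fm x y) \<longleftrightarrow> linked M bs (e x) (e y)"
proof -
  \<comment> \<open>The list \<open>bs'\<close> begins at variable \<open>q + 2\<close>; its tail
    begins at \<open>q + 3\<close>.\<close>
  have "[q + 2..<2 * q + 2] = (q + 2) # [q + 3..<2 * q + 2]"
    using q_pos by (subst upt_conv_Cons) (auto simp: eval_nat_numeral)
  then have tl: "map e [q + 3..<2 * q + 2] = tl bs" using assms(3) by auto
  have "sat M (e(2 * q + 5 := c)) (coded_fm (2 * q + 6) (2 * q + 5) y (x # [q + 3..<2 * q + 2]))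
      \<longleftrightarrow> c \<in> coded M (e y) (e x # tl bs)" for c
  proof -
    let ?e = "e(2 * q + 5 := c)"
    have "map ?e (x # [q + 3..<2 * q + 2]) = e x # tl bs" "?e y = e y" "?e (2 * q + 5) = c"
      using assms by (auto simp flip: tl)
    then show ?thesis
      using assms q_pos by (subst sat_coded_fm) (auto simp del: list.map)
  qed
  then show ?thesis
    using coded_subset unfolding linked_fm_def linked_def by fastforce
qed

lemma sat_outgrown_fm:
  assumes "map e [1..<Suc q] = bs" "map e [q + 2..<2 * q + 2] = bs'"
  shows "sat M e outgrown_fm \<longleftrightarrow> outgrown M (e 0) bs (e (Suc q)) bs'"
proof -
  \<comment> \<open>Inside the quantifiers the assignment changes only from variable
    \<open>2 * q + 2\<close> on, so the parameters keep their values under every such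
    \<open>e'\<close>.\<close>
  have old: "sat M e' (old_fm x) \<longleftrightarrow> e' x \<in> coded M (e 0) bs"
    if "x < 2 * q + 6" "\<And>i. i < 2 * q + 2 \<Longrightarrow> e' i = e i" for e' x
  proof -
    have "map e' [1..<Suc q] = bs" "e' 0 = e 0" using assms(1) that(2) by auto
    then show ?thesis unfolding old_fm_def using that(1) by (subst sat_coded_fm) auto
  qed
  have new: "sat M e' (new_fm x) \<longleftrightarrow> e' x \<in> coded M (e (Suc q)) bs'"
    if "x < 2 * q + 6" "\<And>i. i < 2 * q + 2 \<Longrightarrow> e' i = e i" for e' x
  proof -
    have "map e' [q + 2..<2 * q + 2] = bs'" "e' (Suc q) = e (Suc q)" using assms(2) that(2) by auto
    then show ?thesis unfolding new_fm_def using that(1) by (subst sat_coded_fm) auto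
  qed
  have link: "sat M e' (linked_fm x y) \<longleftrightarrow> linked M bs' (e' x) (e' y)"
    if "x < 2 * q + 5" "y < 2 * q + 5" "\<And>i. i < 2 * q + 2 \<Longrightarrow> e' i = e i" for e' x y
    using that(1,2) by (rule sat_linked_fm) (use assms(2) that(3) in auto)
  have "sat M e outgrown_fm \<longleftrightarrow>
     (\<forall>x\<in>univ M. x \<in> coded M (e 0) bs \<longrightarrow>
        (\<exists>y\<in>univ M. y \<in> coded M (e (Suc q)) bs' \<and> linked M bs' x y)) \<and>
     (\<forall>x\<in>univ M. \<forall>x'\<in>univ M. \<forall>y\<in>univ M. x \<in> coded M (e 0) bs \<longrightarrow> x' \<in> coded M (e 0) bs \<longrightarrow>
        y \<in> coded M (e (Suc q)) bs' \<longrightarrow> linked M bs' x y \<longrightarrow> linked M bs' x' y \<longrightarrow> x = x') \<and>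
     (\<exists>y\<in>univ M. y \<in> coded M (e (Suc q)) bs' \<and>
        (\<forall>x\<in>univ M. x \<in> coded M (e 0) bs \<longrightarrow> \<not> linked M bs' x y))"
    unfolding outgrown_fm_def Let_def by (simp add: old new link)
  also have "\<dots> \<longleftrightarrow> outgrown M (e 0) bs (e (Suc q)) bs'"
    unfolding outgrown_def using coded_subset[of M "e 0" bs] coded_subset[of M "e (Suc q)" bs']
    by (smt (verit) subsetD)
  finally show ?thesis .
qed

lemma sat_growth_fm:
  "sat M e growth_fm \<longleftrightarrow> univ M \<noteq> {} \<and>
     (\<forall>a\<in>univ M. \<forall>bs. length bs = q \<and> set bs \<subseteq> univ M \<longrightarrow>
        (\<exists>a'\<in>univ M. \<exists>bs'. length bs' = q \<and> set bs' \<subseteq> univ M \<and> outgrown M a bs a' bs'))"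
proof -
  have sat: "sat M (override (override e 0 (a # bs)) (Suc q) (a' # bs')) outgrown_fm
      \<longleftrightarrow> outgrown M a bs a' bs'" if len: "length bs = q" "length bs' = q" for a bs a' bs'
  proof -
    let ?e1 = "override e 0 (a # bs)" let ?e = "override ?e1 (Suc q) (a' # bs')"
    have "map ?e1 [0..<0 + Suc q] = a # bs" using len by (intro map_override) simp
    then have e1: "?e1 0 = a" "map ?e1 [1..<Suc q] = bs"
      by (simp_all add: upt_conv_Cons del: upt_Suc)
    have "map ?e [Suc q..<Suc q + Suc q] = a' # bs'" using len by (intro map_override) simp
    moreover have "Suc (q + q) = 2 * q + 1" by simp
    ultimately have e: "?e (Suc q) = a'" "map ?e [q + 2..<2 * q + 2] = bs'"
      by (simp_all add: upt_conv_Cons del: upt_Suc)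
    have "set [1..<Suc q] \<subseteq> {..<Suc q}" by auto
    then have "?e 0 = a" "map ?e [1..<Suc q] = bs"
      using e1 map_override_outside[of "[1..<Suc q]" "Suc q" ?e1 "a' # bs'"]
      by (simp_all only: override_outside zero_less_Suc)
    then show ?thesis using sat_outgrown_fm[of ?e bs bs' M] e by simp
  qed
  have split: "(\<exists>ys. length ys = Suc q \<and> set ys \<subseteq> univ M \<and> P ys) \<longleftrightarrow>
      (\<exists>a\<in>univ M. \<exists>bs. length bs = q \<and> set bs \<subseteq> univ M \<and> P (a # bs))" (is "?l \<longleftrightarrow> ?r") for P
  proof
    assume ?l
    then obtain ys where ys: "length ys = Suc q" "set ys \<subseteq> univ M" "P ys" by blast
    then obtain a bs where "ys = a # bs" by (cases ys) auto
    with ys show ?r by auto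
  next
    assume ?r
    then obtain a bs where "a \<in> univ M" "length bs = q" "set bs \<subseteq> univ M" "P (a # bs)" by blast
    then show ?l by (intro exI[of _ "a # bs"]) simp
  qed
  have "sat M e growth_fm \<longleftrightarrow> univ M \<noteq> {} \<and>
     \<not> (\<exists>a\<in>univ M. \<exists>bs. length bs = q \<and> set bs \<subseteq> univ M \<and>
        \<not> (\<exists>a'\<in>univ M. \<exists>bs'. length bs' = q \<and> set bs' \<subseteq> univ M \<and>
          sat M (override (override e 0 (a # bs)) (Suc q) (a' # bs')) outgrown_fm))"
    unfolding growth_fm_def sat.simps sat_exs split by auto
  also have "\<dots> \<longleftrightarrow> univ M \<noteq> {} \<and>
     (\<forall>a\<in>univ M. \<forall>bs. length bs = q \<and> set bs \<subseteq> univ M \<longrightarrow>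
        (\<exists>a'\<in>univ M. \<exists>bs'. length bs' = q \<and> set bs' \<subseteq> univ M \<and> outgrown M a bs a' bs'))"
    using sat by meson
  finally show ?thesis .
qed

lemma sentence_growth_fm: "sentence growth_fm"
proof -
  have "fv (old_fm x) \<subseteq> insert x {..<2 * q + 2}" for x
    unfolding old_fm_def by (rule order_trans[OF fv_coded_fm]) auto
  moreover have "fv (new_fm x) \<subseteq> insert x {..<2 * q + 2}" for x
    unfolding new_fm_def by (rule order_trans[OF fv_coded_fm]) auto
  moreover have "fv (linked_fm x y) \<subseteq> {x, y} \<union> {..<2 * q + 2}" for x y
  proof -
    have "fv (coded_fm (2 * q + 6) (2 * q + 5) y (x # [q + 3..<2 * q + 2]))
        \<subseteq> {2 * q + 5, y} \<union> set (x # [q + 3..<2 * q + 2])"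
      by (intro fv_coded_fm length_link_params)
    then show ?thesis unfolding linked_fm_def by auto
  qed
  ultimately have "fv outgrown_fm \<subseteq> {..<2 * q + 2}"
    unfolding outgrown_fm_def Let_def by (simp only: fv.simps fv_Imp fv_All) blast
  then show ?thesis by (auto simp: sentence_def growth_fm_def)
qed

section \<open>Failure of the sentence in finite structures\<close>

lemma no_finite_model: "\<not> has_finite_model growth_fm"
proof
  assume "has_finite_model growth_fm"
  then obtain N :: "nat lstruct" where fin: "finite (univ N)" and "sat N (\<lambda>_. 0) growth_fm"
    by (auto simp: has_finite_model_def models_def fin_struct_def)
  then have ne: "univ N \<noteq> {}"
    and grow: "\<And>a bs. a \<in> univ N \<Longrightarrow> length bs = q \<Longrightarrow> set bs \<subseteq> univ N \<Longrightarrow>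
      \<exists>a'\<in>univ N. \<exists>bs'. length bs' = q \<and> set bs' \<subseteq> univ N \<and> outgrown N a bs a' bs'"
    by (auto simp: sat_growth_fm)
  define P where "P = (\<lambda>(a, bs). a \<in> univ N \<and> length bs = q \<and> set bs \<subseteq> univ N)"
  define size where "size = (\<lambda>(a, bs). card (coded N a bs))"
  obtain c where "c \<in> univ N" using ne by auto
  \<comment> \<open>Some pair is needed for a maximum to exist; its coded set may well be
    empty.\<close>
  then have "P (c, replicate q c)" by (auto simp: P_def)
  moreover have "\<forall>s. P s \<longrightarrow> size s < Suc (card (univ N))"
    by (simp add: size_def less_Suc_eq_le card_mono[OF fin coded_subset] split: prod.split)
  ultimately have "\<exists>s. P s \<and> (\<forall>s'. P s' \<longrightarrow> size s' \<le> size s)"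
    by (rule ex_has_greatest_nat)
  then obtain a bs where "P (a, bs)" and max: "\<And>s'. P s' \<Longrightarrow> size s' \<le> size (a, bs)"
    by (metis surj_pair)
  then obtain a' bs' where new: "P (a', bs')" "outgrown N a bs a' bs'"
    using grow[of a bs] by (auto simp: P_def)
  from new(2) obtain y where y: "y \<in> coded N a' bs'" "\<forall>x\<in>coded N a bs. \<not> linked N bs' x y"
    by (auto simp: outgrown_def)
  have "\<forall>x\<in>coded N a bs. \<exists>z. z \<in> coded N a' bs' \<and> linked N bs' x z"
    using new(2) by (auto simp: outgrown_def)
  \<comment> \<open>A choice of links is injective by the second clause of \<open>outgrown\<close>
    and misses \<open>y\<close>, so the new coded set is larger than the maximal one.\<close>
  then obtain g where g: "\<forall>x\<in>coded N a bs. g x \<in> coded N a' bs' \<and> linked N bs' x (g x)"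
    by metis
  have "inj_on g (coded N a bs)"
    using new(2) g unfolding outgrown_def inj_on_def by metis
  moreover have "g ` coded N a bs \<subseteq> coded N a' bs' - {y}" using g y by auto
  moreover have fin': "finite (coded N a' bs')" using fin coded_subset by (rule finite_subset[rotated])
  ultimately have "card (coded N a bs) \<le> card (coded N a' bs' - {y})"
    by (intro card_inj_on_le) auto
  also have "\<dots> < card (coded N a' bs')" using fin' y(1) by (intro psubset_card_mono) auto
  finally show False using max[OF new(1)] by (simp add: size_def)
qed

section \<open>Truth of the sentence in the generic structure\<close>

text \<open>Genericity realises the extension built by \<open>exists_stage\<close> as a strong
  substructure of \<open>M\<close>. Strongness prevents further chains over its parameters from
  appearing elsewhere in \<open>M\<close>, so the absence of links survives as well as their
  presence.\<close>

lemma generic_extension: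
  fixes M :: "'a::infinite lstruct"
  assumes gen: "generic weight M" and A: "strong_in weight A M" "A \<in> Cpos weight"
    and S: "S \<subseteq> univ A"
  obtains a bs where "a \<in> univ M" "length bs = q" "set bs \<subseteq> univ M"
    "\<And>x. x \<in> S \<Longrightarrow> \<exists>y\<in>coded M a bs. linked M bs x y"
    "\<And>x x' y. x \<in> univ A \<Longrightarrow> x' \<in> univ A \<Longrightarrow> y \<in> coded M a bs \<Longrightarrow> linked M bs x y \<Longrightarrow>
      linked M bs x' y \<Longrightarrow> x = x'"
    "\<exists>y\<in>coded M a bs. \<forall>x\<in>univ A. \<not> linked M bs x y"
proof -
  have lA: "lstructure A" and finA: "finite (univ A)" "fin_struct A" "substruct A M"
    using A(1) by (auto simp: strong_in_def fin_struct_def)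
  have triA: "T \<subseteq> univ A \<and> card T = 3" if "T \<in> triples A" for T
  proof -
    obtain x y z where T: "T = {x, y, z}" and xyz: "rel A x y z"
      using \<open>T \<in> triples A\<close> unfolding triples_def by blast
    show ?thesis using lstructureD(1-6)[OF lA xyz] T by simp
  qed
  have "finite S" using S finA by (auto intro: finite_subset)
  then obtain a bs U E w v where st: "stage (univ A) (triples A) a bs (insert v (w ` S)) S U E w"
    and un: "unlinked (univ A) a bs U E v" and "v \<notin> w ` S"
    using exists_stage[OF finA(1) triA _ S] by metis
  note s = stageD[OF st]
  let ?B = "hyperstruct U E"
  have E: "T \<subseteq> U \<and> card T = 3" if "T \<in> E" for T using s(3,4) that by blast
  have lB: "lstructure ?B" and tB: "triples ?B = E"
    using lstructure_hyperstruct[OF E] triples_hyperstruct[OF E] by auto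
  have finB: "fin_struct ?B" using lB s(1) by (simp add: fin_struct_def)
  have AB: "substruct A ?B"
    unfolding substruct_def using lA lB s(2,5) by (auto simp: rel_iff_triple[OF lA])
  have strong: "strong weight A ?B"
    by (rule strict_imp_strong[OF finA(2) finB AB]) (simp add: tB s(6))
  have "strict E {} (univ A)"
    using strong_imp_strict[of empty_struct A ?B] A(2) AB
    by (simp add: Cpos_def tB) (simp add: empty_struct_def)
  \<comment> \<open>The empty set is strict in \<open>A\<close> and \<open>A\<close> is strict in
    \<open>U\<close>; this places \<open>?B\<close> in \<open>Cpos\<close>.\<close>
  then have "strict E {} U" by (rule strict_trans[OF _ s(6)]) simp
  then have "?B \<in> Cpos weight" using finB by (simp add: Cpos_iff tB)
  moreover have "\<forall>A B. strong_in weight A M \<and> strong weight A B \<and> B \<in> Cpos weight \<longrightarrow>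
      (\<exists>B'. substruct B' M \<and> iso_over A B B' \<and> strong_in weight B' M)"
    using gen unfolding generic_def by (elim conjE)
  ultimately obtain B' where B': "substruct B' M" "iso_over A ?B B'" "strong_in weight B' M"
    using A(1) strong by blast
  from B'(2) obtain f where bij: "bij_betw f U (univ B')"
    and rel: "\<And>x y z. x \<in> U \<Longrightarrow> y \<in> U \<Longrightarrow> z \<in> U \<Longrightarrow> {x, y, z} \<in> E \<longleftrightarrow> rel B' (f x) (f y) (f z)"
    and fA: "\<And>x. x \<in> univ A \<Longrightarrow> f x = x"
    unfolding iso_over_def by auto
  have fU: "f x \<in> univ B'" if "x \<in> U" for x using bij that by (auto simp: bij_betw_def)
  have inj: "inj_on f U" using bij by (simp add: bij_betw_def)
  have B'M: "univ B' \<subseteq> univ M" using B'(1) by (simp add: substruct_def)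
  have relM: "{x, y, z} \<in> E \<longleftrightarrow> rel M (f x) (f y) (f z)" if "x \<in> U" "y \<in> U" "z \<in> U" for x y z
    using rel[OF that] fU that B'(1) unfolding substruct_def by blast
  have coded_image: "f u \<in> coded M (f c) (map f cs)"
    if u: "u \<in> coded ?B c cs" and c: "c \<in> U" "set cs \<subseteq> U" for u c cs
  proof -
    obtain xs where xs: "chain ?B c cs xs" "u = xs ! 0" using u by (auto simp: coded_def)
    then have len: "length xs = p" "length cs = q" and dist: "distinct (c # cs @ xs)"
      and xsU: "set xs \<subseteq> U" and
      E: "\<And>l j. l < p \<Longrightarrow> j < inc l \<Longrightarrow> {xs ! l, (c # xs) ! l, cs ! j} \<in> E"
      by (auto simp: chain_def)
    have sub: "set (c # cs @ xs) \<subseteq> U" using xsU c by simp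
    have "distinct (map f (c # cs @ xs))"
      unfolding distinct_map using dist inj_on_subset[OF inj sub] by blast
    moreover have "rel M (map f xs ! l) ((f c # map f xs) ! l) (map f cs ! j)"
      if "l < p" "j < inc l" for l j
    proof -
      have j: "j < q" using that inc_le[of l] by simp
      have "(c # xs) ! l \<in> set (c # xs)" using that len by (intro nth_mem) simp
      then have "xs ! l \<in> U" "(c # xs) ! l \<in> U" "cs ! j \<in> U"
        using that len j sub by (auto simp: subset_eq)
      moreover have "(f c # map f xs) ! l = f ((c # xs) ! l)"
        using that len by (cases l) auto
      ultimately show ?thesis using E[OF that] relM that len j by simp
    qed
    moreover have "set (map f xs) \<subseteq> univ M" using xsU fU B'M by auto
    ultimately have "chain M (f c) (map f cs) (map f xs)" using len by (simp add: chain_def)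
    moreover have "map f xs ! 0 = f u" using xs(2) len p_pos by simp
    ultimately show ?thesis unfolding coded_def by force
  qed
  \<comment> \<open>A chain in \<open>M\<close> over parameters from the strong copy lies inside the
    copy, so its first relation comes from \<open>E\<close>.\<close>
  have codedE: "\<exists>u\<in>U. y = f u \<and> {u, c, cs ! 0} \<in> E"
    if y: "y \<in> coded M (f c) (map f cs)" and c: "c \<in> U" "set cs \<subseteq> U" for y c cs
  proof -
    obtain xs where xs: "chain M (f c) (map f cs) xs" "y = xs ! 0" using y by (auto simp: coded_def)
    have "set xs \<subseteq> univ B'"
      using c fU by (intro chain_in_strong[OF B'(3) xs(1)]) auto
    moreover have "length xs = p" "length cs = q" using xs(1) by (auto simp: chain_def)
    ultimately have "y \<in> univ B'" using xs(2) p_pos by auto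
    then obtain u where u: "u \<in> U" "y = f u" using bij by (auto simp: bij_betw_def)
    have "cs ! 0 \<in> U" "map f cs ! 0 = f (cs ! 0)" using c \<open>length cs = q\<close> q_pos by auto
    then have "{u, c, cs ! 0} \<in> E" using chain_rel_0[OF xs(1)] relM u c(1) xs(2) by simp
    then show ?thesis using u by blast
  qed
  have bsU: "set bs \<subseteq> U" "bs \<noteq> []" using s(9,11) q_pos by auto
  then have tlU: "set (tl bs) \<subseteq> U" by (auto dest: list.set_sel(2))
  have link: "\<exists>z. {z, u, x} \<in> E" if l: "linked M (map f bs) x (f u)" "x \<in> univ A" "u \<in> U" for x u
  proof -
    have map: "map f (x # tl bs) = x # tl (map f bs)" using l(2) fA by (simp add: map_tl)
    obtain z where "z \<in> coded M (f u) (map f (x # tl bs))"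
      using l(1) unfolding linked_def map by auto
    then show ?thesis using codedE[of z u "x # tl bs"] l s(2) tlU by auto
  qed
  have linkI: "linked M (map f bs) x (f u)"
    if u: "coded ?B u (x # tl bs) \<noteq> {}" "x \<in> univ A" "u \<in> U" for x u
  proof -
    have map: "map f (x # tl bs) = x # tl (map f bs)" using u(2) fA by (simp add: map_tl)
    show ?thesis
      using coded_image[of _ u "x # tl bs"] u s(2) tlU unfolding linked_def map by auto
  qed
  have wU: "w x \<in> U" if "x \<in> S" for x using s(13) that by auto
  have v: "v \<in> U" "v \<in> coded ?B a bs" "\<And>y z. y \<in> univ A \<Longrightarrow> {z, v, y} \<notin> E"
    using un by (auto simp: unlinked_def)
  show thesis
  proof (rule that)
    show "f a \<in> univ M" "length (map f bs) = q" "set (map f bs) \<subseteq> univ M"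
      using s(7,11) bsU fU B'M by auto
    show "\<exists>y\<in>coded M (f a) (map f bs). linked M (map f bs) x y" if "x \<in> S" for x
      using coded_image[OF s(14)[OF that] s(7) bsU(1)] linkI[OF s(15)[OF that] _ wU[OF that]] S that
      by blast
    show "x = x'"
      if x: "x \<in> univ A" "x' \<in> univ A" and y: "y \<in> coded M (f a) (map f bs)"
        and l: "linked M (map f bs) x y" "linked M (map f bs) x' y" for x x' y
    proof -
      obtain u where u: "u \<in> U" "y = f u" "{u, a, bs ! 0} \<in> E"
        using codedE[OF y s(7) bsU(1)] by blast
      then obtain z z' where z: "{z, u, x} \<in> E" "{z', u, x'} \<in> E" using link x l by metis
      \<comment> \<open>The coded points are the reserve \<open>v\<close>, which shares no relation
        with a point of \<open>A\<close>, and the targets \<open>w t\<close>, which share one only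
        with \<open>t\<close>.\<close>
      from s(16)[OF u(3)] consider "u = v" | t where "t \<in> S" "u = w t" by auto
      then show ?thesis
      proof cases
        case 1
        then show ?thesis using z v(3) x by blast
      next
        case 2
        then show ?thesis using s(17)[of t x z] s(17)[of t x' z'] z x by simp
      qed
    qed
    show "\<exists>y\<in>coded M (f a) (map f bs). \<forall>x\<in>univ A. \<not> linked M (map f bs) x y"
      using coded_image[OF v(2) s(7) bsU(1)] link[OF _ _ v(1)] v(3) by blast
  qed
qed

lemma generic_models_growth:
  fixes M :: "'a::infinite lstruct"
  assumes gen: "generic weight M"
  shows "sat M e growth_fm"
  unfolding sat_growth_fm
proof (intro conjI ballI allI impI; (elim conjE)?)
  obtain A where "strong_in weight A M" "A \<in> Cpos weight"
    using finite_subset_strong_in[OF gen, of "{}"] by auto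
  \<comment> \<open>The base point obtained from the extension lies in \<open>M\<close>, so
    \<open>M\<close> is nonempty.\<close>
  from generic_extension[OF gen this, of "{}"] show "univ M \<noteq> {}" by auto
  fix a bs assume a: "a \<in> univ M" and bs: "length bs = q" "set bs \<subseteq> univ M"
  obtain A where A: "insert a (set bs) \<subseteq> univ A" "strong_in weight A M" "A \<in> Cpos weight"
    using finite_subset_strong_in[OF gen, of "insert a (set bs)"] a bs by auto
  \<comment> \<open>As the parameters lie in \<open>A\<close>, so does the whole coded set, and it
    can serve as the set \<open>S\<close> to be linked.\<close>
  have sub: "coded M a bs \<subseteq> univ A" using A by (intro coded_in_strong) auto
  show "\<exists>a'\<in>univ M. \<exists>bs'. length bs' = q \<and> set bs' \<subseteq> univ M \<and> outgrown M a bs a' bs'"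
  proof (rule generic_extension[OF gen A(2,3) sub])
    fix a' bs'
    assume ext: "a' \<in> univ M" "length bs' = q" "set bs' \<subseteq> univ M"
      and cover: "\<And>x. x \<in> coded M a bs \<Longrightarrow> \<exists>y\<in>coded M a' bs'. linked M bs' x y"
      and inj: "\<And>x x' y. x \<in> univ A \<Longrightarrow> x' \<in> univ A \<Longrightarrow> y \<in> coded M a' bs' \<Longrightarrow>
        linked M bs' x y \<Longrightarrow> linked M bs' x' y \<Longrightarrow> x = x'"
      and fresh: "\<exists>y\<in>coded M a' bs'. \<forall>x\<in>univ A. \<not> linked M bs' x y"
    have "outgrown M a bs a' bs'"
      unfolding outgrown_def
    proof (intro conjI ballI impI)
      show "\<exists>y\<in>coded M a' bs'. \<forall>x\<in>coded M a bs. \<not> linked M bs' x y" using fresh sub by blast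
      show "\<exists>y\<in>coded M a' bs'. linked M bs' x y" if "x \<in> coded M a bs" for x
        using that by (rule cover)
      show "x = x'" if "x \<in> coded M a bs" "x' \<in> coded M a bs" "y \<in> coded M a' bs'"
        "linked M bs' x y" "linked M bs' x' y" for x x' y
        using that sub by (intro inj[of x x' y]) auto
    qed
    then show ?thesis using ext by blast
  qed
qed

end

theorem theorem3p4:
  fixes \<alpha> :: real and M :: "'a::infinite lstruct"
  assumes "0 < \<alpha>" and "\<alpha> \<le> 1" and "\<alpha> \<in> \<rat>"
    and "generic \<alpha> M"
  shows "\<not> struct_fmp M \<and> \<not> theory_fmp (Th M)"
proof -
  obtain p q :: nat where q: "q \<noteq> 0" and "\<bar>\<alpha>\<bar> = real p / real q"
    using assms(3) Rats_abs_nat_div_natE by metis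
  then have \<alpha>: "\<alpha> = real p / real q" using assms(1) by simp
  \<comment> \<open>Positivity of \<open>\<alpha>\<close> gives \<open>0 < p\<close>, and
    \<open>\<alpha> \<le> 1\<close> gives \<open>p \<le> q\<close>.\<close>
  interpret rational_weight p q
    using assms(1,2) q \<alpha> by unfold_locales (auto simp: field_simps zero_less_divide_iff)
  have "generic weight M" using assms(4) \<alpha> by (simp add: weight_def)
  then have "models M growth_fm" by (simp add: models_def generic_models_growth)
  then show ?thesis
    using sentence_growth_fm no_finite_model by (auto simp: struct_fmp_def theory_fmp_def Th_def)
qed

end
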